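(* Let $V\subseteq R_d$ be a monomial vector space which is both Gotzmann and Gotzmann-dual. Then $V$ is a lex segment with respect to some ordering of the variables, i.e. there is an ordering $x_{\pi(1)}>\dots>x_{\pi(n)}$ such that $V$ is spanned by an initial segment of the squarefree degree-$d$ monomials in the corresponding lexicographic order.
   Context: Let $\Bbbk$ be a field, $R=\Bbbk[x_1,\dots,x_n]/(x_1^2,\dots,x_n^2)$, $R_d$ its degree-$d$ component. A monomial vector space is a subspace of some $R_d$ spanned by monomials; $\mathbf m_1V$ is the span of $\{x_jm\}$ over monomials $m\in V$ and all $j$. A subspace $V\subseteq R_d$ is Gotzmann if $|\mathbf m_1V|\le|\mathbf m_1W|$ for every subspace $W\subseteq R_d$ with $|W|=|V|$ ($|\cdot|$ = dimension). The Alexander dual of a monomial vector space $V\subseteq R_d$ is $V^\vee\subseteq R_{n-d}$, spanned by the monomials $\mathbf x/m$ for squarefree monomials $m$ of degree $d$ not in $V$, where $\mathbf x=x_1\cdots x_n$. $V$ is Gotzmann-dual if $V^\vee$ is Gotzmann. *)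

theory Defs
  imports Complex_Main "HOL-Library.Function_Algebras"
begin

text \<open>Model of R = k[x_0,...,x_{n-1}]/(x_i^2).  The squarefree monomial
  x_S = prod_{i in S} x_i is identified with the finite set S of variable
  indices; R_d is the k-vector space of coefficient functions
  (nat set => 'k) supported on the d-subsets of {0..<n}.\<close>

definition sqfree :: "nat \<Rightarrow> nat \<Rightarrow> nat set set" where
  "sqfree n d = {S. S \<subseteq> {0..<n} \<and> card S = d}"

definition scal :: "'k::field \<Rightarrow> (nat set \<Rightarrow> 'k) \<Rightarrow> (nat set \<Rightarrow> 'k)" where
  "scal c f = (\<lambda>S. c * f S)"

lemma vector_space_scal: "vector_space (scal :: 'k::field \<Rightarrow> _)"
  by unfold_locales (auto simp: scal_def fun_eq_iff algebra_simps)

definition Rdeg :: "nat \<Rightarrow> nat \<Rightarrow> (nat set \<Rightarrow> 'k::field) set" where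
  "Rdeg n d = {f. \<forall>S. S \<notin> sqfree n d \<longrightarrow> f S = 0}"

definition mono :: "nat set \<Rightarrow> (nat set \<Rightarrow> 'k::field)" where
  "mono S = (\<lambda>T. if T = S then 1 else 0)"

definition mulx :: "nat \<Rightarrow> (nat set \<Rightarrow> 'k::field) \<Rightarrow> (nat set \<Rightarrow> 'k)" where
  "mulx j f = (\<lambda>T. if j \<in> T then f (T - {j}) else 0)"

abbreviation vspan :: "(nat set \<Rightarrow> 'k::field) set \<Rightarrow> (nat set \<Rightarrow> 'k) set" where
  "vspan \<equiv> module.span scal"

abbreviation vsubspace :: "(nat set \<Rightarrow> 'k::field) set \<Rightarrow> bool" where
  "vsubspace \<equiv> module.subspace scal"

abbreviation vdim :: "(nat set \<Rightarrow> 'k::field) set \<Rightarrow> nat" where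
  "vdim \<equiv> vector_space.dim scal"

definition m1 :: "nat \<Rightarrow> (nat set \<Rightarrow> 'k::field) set \<Rightarrow> (nat set \<Rightarrow> 'k) set" where
  "m1 n W = vspan {mulx j w | j w. j < n \<and> w \<in> W}"

definition monospace :: "nat set set \<Rightarrow> (nat set \<Rightarrow> 'k::field) set" where
  "monospace M = vspan (mono ` M)"

definition gotzmann :: "nat \<Rightarrow> nat \<Rightarrow> (nat set \<Rightarrow> 'k::field) set \<Rightarrow> bool" where
  "gotzmann n d V \<longleftrightarrow>
     (\<forall>W :: (nat set \<Rightarrow> 'k) set. vsubspace W \<and> W \<subseteq> Rdeg n d \<and> vdim W = vdim V \<longrightarrow> vdim (m1 n V) \<le> vdim (m1 n W))"

definition alex_dual :: "nat \<Rightarrow> nat \<Rightarrow> nat set set \<Rightarrow> nat set set" where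
  "alex_dual n d M = {{0..<n} - S | S. S \<in> sqfree n d \<and> S \<notin> M}"

definition gotzmann_dual :: "nat \<Rightarrow> nat \<Rightarrow> nat set set \<Rightarrow> bool" where
  "gotzmann_dual n d M \<longleftrightarrow>
     gotzmann n (n - d) (monospace (alex_dual n d M) :: (nat set \<Rightarrow> 'k::field) set)"

text \<open>Lex order on squarefree monomials of the same degree w.r.t. the variable order
  x_{p 0} > x_{p 1} > ... > x_{p (n-1)} (p a bijection of {0..<n}): S >lex T iff the largest variable
  (smallest position under p) in the symmetric difference lies in S.\<close>
definition lex_gt :: "nat \<Rightarrow> (nat \<Rightarrow> nat) \<Rightarrow> nat set \<Rightarrow> nat set \<Rightarrow> bool" where
  "lex_gt n p S T \<longleftrightarrow> (\<exists>k<n. p k \<in> S \<and> p k \<notin> T \<and> (\<forall>i<k. p i \<in> S \<longleftrightarrow> p i \<in> T))"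

definition lex_segment :: "nat \<Rightarrow> nat \<Rightarrow> (nat \<Rightarrow> nat) \<Rightarrow> nat set set \<Rightarrow> bool" where
  "lex_segment n d p M \<longleftrightarrow> M \<subseteq> sqfree n d \<and>
     (\<forall>S\<in>M. \<forall>T\<in>sqfree n d. lex_gt n p T S \<longrightarrow> T \<in> M)"

end

theory Submission
  imports Defs "HOL-Library.Nat_Bijection"
begin

text \<open>A monomial space is Gotzmann only if its set of monomials has minimal upper shadow among the
  families of the same size, so the hypotheses say that \<open>M\<close> has minimal upper shadow and that its
  complement \<open>B\<close> has minimal lower shadow. Complementing each monomial, both become minimality in the
  Kruskal--Katona theorem. For a variable \<open>x\<close> split \<open>M\<close> into its link \<open>M\<^sub>1\<close> and deletion \<open>M\<^sub>0\<close>. Unless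
  the upper shadow of \<open>M\<^sub>1\<close> lies in \<open>M\<^sub>0\<close>, which cannot happen for all \<open>x\<close> when \<open>M\<close> is nontrivial, both
  parts inherit the two minimality properties, and \<open>M\<^sub>0\<close> lies in the upper shadow of \<open>M\<^sub>1\<close>.
  Induction then shows that \<open>M\<close> is contained in, or contains, the star of some variable: in the
  remaining configurations one of \<open>M\<close> and \<open>B\<close> could be rearranged to have a smaller shadow, because
  the minimal shadow size is strictly subadditive. That variable is the first one of the ordering, and the
  others are found recursively.\<close>

section \<open>Colexicographic order on finite sets of naturals, through binary encodings\<close>

text \<open>Binary numbers are compared at the highest digit where they differ, because the digits
  below position \<open>m\<close> add up to less than \<open>2 ^ m\<close>.\<close>

lemma set_encode_less_iff:
  assumes "finite S" "finite T"
  shows "set_encode S < set_encode T \<longleftrightarrow> (\<exists>m. m \<in> T \<and> m \<notin> S \<and> (\<forall>i>m. i \<in> S \<longleftrightarrow> i \<in> T))"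
proof -
  have less: "set_encode S < set_encode T"
    if fin: "finite S" "finite T" and m: "m \<in> T" "m \<notin> S" "\<And>i. i > m \<Longrightarrow> i \<in> S \<longleftrightarrow> i \<in> T" for S T m
  proof -
    let ?H = "{i \<in> S. i > m}" and ?L = "{i \<in> S. i < m}"
    have S: "S = ?H \<union> ?L" using m(2) by (auto simp: nat_neq_iff) (metis nat_neq_iff)
    have "set_encode S = sum ((^) 2) ?H + sum ((^) 2) ?L"
      unfolding set_encode_def by (subst S, rule sum.union_disjoint) (use fin in auto)
    also have "sum ((^) 2) ?L \<le> (\<Sum>i<m. 2 ^ i :: nat)"
      by (rule sum_mono2) auto
    also have "\<dots> < 2 ^ m" by (induction m) auto
    also have "sum ((^) 2) ?H + 2 ^ m = sum ((^) 2 :: nat \<Rightarrow> nat) (insert m ?H)"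
      using fin by simp
    also have "\<dots> \<le> set_encode T"
      unfolding set_encode_def by (rule sum_mono2) (use fin m in auto)
    finally show ?thesis by simp
  qed
  show ?thesis
  proof
    assume lt: "set_encode S < set_encode T"
    let ?D = "(S - T) \<union> (T - S)"
    have fD: "finite ?D" and neD: "?D \<noteq> {}" using assms lt by auto
    define m where "m = Max ?D"
    have mD: "m \<in> ?D" using Max_in[OF fD neD] by (simp add: m_def)
    have above: "i \<in> S \<longleftrightarrow> i \<in> T" if "i > m" for i
    proof (rule ccontr)
      assume "(i \<in> S) \<noteq> (i \<in> T)"
      hence "i \<le> m" unfolding m_def by (intro Max_ge fD) auto
      with that show False by simp
    qed
    have "\<not> (m \<in> S \<and> m \<notin> T)"
      using less[OF assms(2,1), of m] above lt by (meson less_asym')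
    thus "\<exists>m. m \<in> T \<and> m \<notin> S \<and> (\<forall>i>m. i \<in> S \<longleftrightarrow> i \<in> T)"
      using mD above by blast
  qed (use less[OF assms] in blast)
qed

section \<open>Layers, shadows, links and deletions\<close>

text \<open>Finiteness is demanded separately because \<open>X\<close> is often \<open>UNIV\<close>,
  where an infinite set would have \<open>card\<close> 0.\<close>

definition layer :: "'a set \<Rightarrow> nat \<Rightarrow> 'a set set" where
  "layer X k = {S. S \<subseteq> X \<and> finite S \<and> card S = k}"

definition shadow :: "'a set set \<Rightarrow> 'a set set" where
  "shadow F = {S - {x} | S x. S \<in> F \<and> x \<in> S}"

definition link :: "'a \<Rightarrow> 'a set set \<Rightarrow> 'a set set" where
  "link x F = {S. x \<notin> S \<and> insert x S \<in> F}"

definition del :: "'a \<Rightarrow> 'a set set \<Rightarrow> 'a set set" where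
  "del x F = {S \<in> F. x \<notin> S}"

lemma finite_layer [simp]: "finite X \<Longrightarrow> finite (layer X k)"
  unfolding layer_def by (rule finite_subset[of _ "Pow X"]) auto

lemma layer_mono: "X \<subseteq> Y \<Longrightarrow> layer X k \<subseteq> layer Y k"
  by (auto simp: layer_def)

lemma card_layer: "finite X \<Longrightarrow> card (layer X k) = card X choose k"
proof -
  assume "finite X"
  hence "layer X k = {S. S \<subseteq> X \<and> card S = k}" by (auto simp: layer_def intro: finite_subset)
  thus ?thesis using n_subsets[OF \<open>finite X\<close>] by simp
qed

lemma shadowI: "S \<in> F \<Longrightarrow> x \<in> S \<Longrightarrow> S - {x} \<in> shadow F"
  by (auto simp: shadow_def)

lemma shadow_insertI: "insert x S \<in> F \<Longrightarrow> x \<notin> S \<Longrightarrow> S \<in> shadow F"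
  using shadowI[of "insert x S" F x] by simp

lemma shadowE:
  assumes "T \<in> shadow F"
  obtains x where "x \<notin> T" "insert x T \<in> F"
proof -
  from assms obtain S x where "T = S - {x}" "S \<in> F" "x \<in> S" by (auto simp: shadow_def)
  thus ?thesis using that[of x] by (simp add: insert_absorb)
qed

lemma shadow_iff: "T \<in> shadow F \<longleftrightarrow> (\<exists>x. x \<notin> T \<and> insert x T \<in> F)"
  by (meson shadowE shadow_insertI)

lemma shadow_Un: "shadow (F \<union> G) = shadow F \<union> shadow G"
  by (auto simp: shadow_def)

lemma shadow_layer: "F \<subseteq> layer X k \<Longrightarrow> shadow F \<subseteq> layer X (k - 1)"
  by (auto simp: shadow_def layer_def)

lemma finite_shadow [simp]: "F \<subseteq> layer X k \<Longrightarrow> finite F \<Longrightarrow> finite (shadow F)"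
proof -
  assume F: "F \<subseteq> layer X k" "finite F"
  have "shadow F \<subseteq> Pow (\<Union>F)" by (auto simp: shadow_def)
  moreover have "finite (\<Union>F)" using F by (auto simp: layer_def)
  ultimately show ?thesis by (meson finite_Pow_iff finite_subset)
qed

lemma link_layer: "F \<subseteq> layer X k \<Longrightarrow> link x F \<subseteq> layer (X - {x}) (k - 1)"
  by (fastforce simp: link_def layer_def)

lemma del_layer: "F \<subseteq> layer X k \<Longrightarrow> del x F \<subseteq> layer (X - {x}) k"
  by (auto simp: del_def layer_def)

lemma inj_on_insert: "inj_on (insert x) {S. x \<notin> S}"
  by (rule inj_onI) (metis Diff_insert_absorb mem_Collect_eq)

lemma card_image_insert: "(\<And>S. S \<in> F \<Longrightarrow> x \<notin> S) \<Longrightarrow> card (insert x ` F) = card F"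
  by (rule card_image, rule inj_on_subset[OF inj_on_insert]) auto

lemma link_del_decomp: "F = insert x ` link x F \<union> del x F"
proof -
  have "S \<in> insert x ` link x F" if "S \<in> F" "x \<in> S" for S
    using that by (intro image_eqI[of _ _ "S - {x}"]) (auto simp: link_def insert_absorb)
  thus ?thesis by (auto simp: link_def del_def)
qed

lemma finite_link [simp]: "finite F \<Longrightarrow> finite (link x F)"
proof -
  assume "finite F"
  hence "finite (insert x ` link x F)"
    by (rule finite_subset[rotated]) (auto simp: link_def)
  thus ?thesis by (rule finite_imageD) (rule inj_on_subset[OF inj_on_insert], auto simp: link_def)
qed

lemma finite_del [simp]: "finite F \<Longrightarrow> finite (del x F)"
  by (simp add: del_def)

lemma card_link_del:
  assumes "finite F" shows "card F = card (link x F) + card (del x F)"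
proof -
  have "card F = card (insert x ` link x F) + card (del x F)"
    by (subst link_del_decomp[of F x], rule card_Un_disjoint) (use assms in \<open>auto simp: del_def\<close>)
  also have "card (insert x ` link x F) = card (link x F)"
    by (rule card_image_insert) (auto simp: link_def)
  finally show ?thesis .
qed

lemma link_shadow: "link x (shadow F) = shadow (link x F)"
  by (auto simp: link_def shadow_iff insert_commute)

text \<open>A set of the shadow that avoids \<open>x\<close> arises either by deleting
  \<open>x\<close> itself or by deleting another point from a set without \<open>x\<close>.\<close>

lemma del_shadow: "del x (shadow F) = link x F \<union> shadow (del x F)"
  by (auto simp: del_def link_def shadow_iff)

text \<open>The recursion behind all later shadow estimates. The link enters twice: through its own
  shadow, and in competition with the shadow of the deletion.\<close>

lemma card_shadow:
  assumes "F \<subseteq> layer X k" "finite F"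
  shows "card (shadow F) = card (shadow (link x F)) + card (link x F \<union> shadow (del x F))"
  using card_link_del[of "shadow F" x] assms by (simp add: link_shadow del_shadow)

text \<open>Used to change the two parts of a family independently and put them together
  again.\<close>

lemma link_glue: "(\<And>S. S \<in> F1 \<union> F0 \<Longrightarrow> x \<notin> S) \<Longrightarrow> link x (insert x ` F1 \<union> F0) = F1"
  by (auto simp: link_def) (metis insert_ident)

lemma del_glue: "(\<And>S. S \<in> F1 \<union> F0 \<Longrightarrow> x \<notin> S) \<Longrightarrow> del x (insert x ` F1 \<union> F0) = F0"
  by (auto simp: del_def)

lemma glue_layer:
  assumes "F1 \<subseteq> layer (X - {x}) (k - 1)" "F0 \<subseteq> layer (X - {x}) k" "x \<in> X" "k \<ge> 1"
  shows "insert x ` F1 \<union> F0 \<subseteq> layer X k"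
proof -
  have "insert x S \<in> layer X k" if "S \<in> layer (X - {x}) (k - 1)" for S
    using that assms(3,4) by (auto simp: layer_def subset_Diff_insert)
  moreover have "layer (X - {x}) k \<subseteq> layer X k" by (rule layer_mono) auto
  ultimately show ?thesis using assms(1,2) by blast
qed

text \<open>Initial segments of the colexicographic order, which on finite sets of naturals
  is the order of their binary encodings.\<close>

definition initial :: "nat set \<Rightarrow> nat \<Rightarrow> nat set set \<Rightarrow> bool" where
  "initial X k F \<longleftrightarrow> finite F \<and> F \<subseteq> layer X k \<and>
     (\<forall>T\<in>F. \<forall>S\<in>layer X k. set_encode S < set_encode T \<longrightarrow> S \<in> F)"

lemma initial_nested:
  assumes "initial X k F" "initial X k G" shows "F \<subseteq> G \<or> G \<subseteq> F"
proof (rule ccontr)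
  assume "\<not> ?thesis"
  then obtain S T where S: "S \<in> F" "S \<notin> G" and T: "T \<in> G" "T \<notin> F" by blast
  have l: "S \<in> layer X k" "T \<in> layer X k" using S T assms by (auto simp: initial_def)
  hence "\<not> set_encode S < set_encode T" "\<not> set_encode T < set_encode S"
    using S T assms by (auto simp: initial_def)
  hence "set_encode S = set_encode T" by simp
  hence "S = T" using l set_encode_eq by (auto simp: layer_def)
  thus False using S T by simp
qed

lemma initial_card_Un:
  assumes "initial X k F" "initial X k G" shows "card (F \<union> G) = max (card F) (card G)"
proof -
  have "finite F" "finite G" using assms by (auto simp: initial_def)
  thus ?thesis using initial_nested[OF assms]
    by (metis card_mono max.orderE max.commute sup.absorb1 sup.absorb2)
qed

text \<open>If \<open>S\<close> precedes a member \<open>T\<close> of the shadow, the earliest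
  extension of \<open>S\<close> by one point is compared with the extension of \<open>T\<close> that
  lies in \<open>F\<close>: it comes before it or coincides with it.\<close>

lemma initial_shadow:
  assumes "initial X k F" "k \<ge> 1"
  shows "initial X (k - 1) (shadow F)"
proof -
  have F: "finite F" "F \<subseteq> layer X k"
    "\<And>S T. T \<in> F \<Longrightarrow> S \<in> layer X k \<Longrightarrow> set_encode S < set_encode T \<Longrightarrow> S \<in> F"
    using assms(1) by (auto simp: initial_def)
  have "S \<in> shadow F" if T: "T \<in> shadow F" and S: "S \<in> layer X (k - 1)"
    and lt: "set_encode S < set_encode T" for S T
  proof -
    obtain x where x: "x \<notin> T" "insert x T \<in> F" using T by (rule shadowE)
    have xX: "x \<in> X" "T \<subseteq> X" and fin: "finite S" "finite T" and c: "card S = card T"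
      using x F(2) S by (auto simp: layer_def)
    have eT: "set_encode (insert x T) = 2 ^ x + set_encode T" using x fin by simp
    obtain m where m: "m \<in> T" "m \<notin> S" "\<And>i. i > m \<Longrightarrow> i \<in> S \<longleftrightarrow> i \<in> T"
      using lt fin by (auto simp: set_encode_less_iff)
    have ex: "\<exists>y. y \<in> X - S" using m xX by auto
    \<comment> \<open>The least free point gives the extension of \<open>S\<close> with the smallest
      encoding.\<close>
    define y where "y = (LEAST y. y \<in> X - S)"
    have y: "y \<in> X - S" unfolding y_def by (rule LeastI_ex[OF ex])
    have ymin: "y \<le> i" if "i \<in> X - S" for i unfolding y_def using that by (rule Least_le)
    have yS: "insert y S \<in> layer X k" and ynS: "y \<notin> S" using y S assms(2) by (auto simp: layer_def)
    have eS: "set_encode (insert y S) = 2 ^ y + set_encode S" using ynS fin by simp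
    show ?thesis
    proof (cases "y \<le> x")
      case True
      hence "(2::nat) ^ y \<le> 2 ^ x" by simp
      hence "set_encode (insert y S) < set_encode (insert x T)" using eS eT lt by linarith
      thus ?thesis using F(3)[OF x(2) yS] ynS by (simp add: shadow_insertI)
    next
      case False
      have xm: "y \<le> m" using ymin m xX by auto
      show ?thesis
      proof (cases "y = m")
        case False
        have "set_encode (insert y S) < set_encode (insert x T)"
          by (subst set_encode_less_iff)
            (use fin m xm False \<open>\<not> y \<le> x\<close> in \<open>auto intro!: exI[of _ m]\<close>)
        thus ?thesis using F(3)[OF x(2) yS] ynS by (simp add: shadow_insertI)
      next
        case True
        \<comment> \<open>All points of \<open>X\<close> below \<open>m\<close> lie in
          \<open>S\<close>, and above \<open>m\<close> the sets agree, so the two extensions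
          coincide by size.\<close>
        have sub: "insert x T \<subseteq> insert y S"
        proof
          fix i assume i: "i \<in> insert x T"
          have iX: "i \<in> X" using i xX by auto
          consider "i < y" | "i = y" | "i > m" using True by linarith
          thus "i \<in> insert y S"
          proof cases
            case 1
            thus ?thesis using ymin[of i] iX by auto
          next
            case 3
            thus ?thesis using i m(3)[of i] False True by auto
          qed auto
        qed
        have "insert x T = insert y S"
          by (rule card_subset_eq[OF _ sub]) (use fin x ynS c in auto)
        thus ?thesis using x(2) ynS by (simp add: shadow_insertI)
      qed
    qed
  qed
  thus ?thesis using F shadow_layer[OF F(2)] by (auto simp: initial_def)
qed

lemma initial_exists:
  assumes "finite X" "m \<le> card X choose k"
  obtains F where "initial X k F" "card F = m"
proof -
  have "\<exists>F. initial X k F \<and> card F = m" using assms(2)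
  proof (induction m)
    case 0
    show ?case by (rule exI[of _ "{}"]) (simp add: initial_def)
  next
    case (Suc m)
    then obtain F where F: "initial X k F" "card F = m" by auto
    have fF: "finite F" "F \<subseteq> layer X k" using F by (auto simp: initial_def)
    have "F \<noteq> layer X k" using F Suc.prems card_layer[OF assms(1)] by auto
    hence ne: "\<exists>S. S \<in> layer X k - F" using fF by auto
    define S where "S = arg_min set_encode (\<lambda>S. S \<in> layer X k - F)"
    have S: "S \<in> layer X k - F" unfolding S_def using ne by (rule arg_min_natI[of _ _, OF someI_ex])
    have Smin: "set_encode S \<le> set_encode T" if "T \<in> layer X k - F" for T
      unfolding S_def using that by (rule arg_min_nat_le)
    have "initial X k (insert S F)"
      using F(1) S Smin by (fastforce simp: initial_def)
    moreover have "card (insert S F) = Suc m" using S F fF by simp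
    ultimately show ?case by blast
  qed
  thus ?thesis using that by blast
qed

text \<open>A set that precedes a subset of \<open>{..<N}\<close> in colexicographic order has no
  point beyond \<open>N\<close> either, so the segments do not depend on \<open>N\<close>.\<close>

lemma initial_lessThan_UNIV:
  assumes "initial {..<N} k F" shows "initial UNIV k F"
proof -
  have "S \<in> F" if T: "T \<in> F" and S: "S \<in> layer UNIV k" and lt: "set_encode S < set_encode T" for S T
  proof -
    have TN: "T \<in> layer {..<N} k" using T assms by (auto simp: initial_def)
    have fin: "finite S" "finite T" using S TN by (auto simp: layer_def)
    obtain m where m: "m \<in> T" "m \<notin> S" "\<And>i. i > m \<Longrightarrow> i \<in> S \<longleftrightarrow> i \<in> T"
      using lt fin by (auto simp: set_encode_less_iff)
    have "S \<subseteq> {..<N}"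
    proof
      fix i assume "i \<in> S"
      moreover have "m < N" using m(1) TN by (auto simp: layer_def)
      ultimately show "i \<in> {..<N}" using m TN
        by (cases "i > m") (auto simp: layer_def)
    qed
    hence "S \<in> layer {..<N} k" using S by (auto simp: layer_def)
    thus ?thesis using assms T lt by (auto simp: initial_def)
  qed
  moreover have "F \<subseteq> layer UNIV k" "finite F"
    using assms layer_mono[of "{..<N}" UNIV k] by (auto simp: initial_def)
  ultimately show ?thesis unfolding initial_def by blast
qed

section \<open>The Kruskal-Katona theorem by compression\<close>

text \<open>Every set of \<open>I - A\<close> precedes every set of \<open>A - I\<close>, so any
  bijection between these differences raises all encodings. The sum serves as the potential that
  compression lowers.\<close>

lemma initial_sum_le:
  assumes I: "initial X k I" and A: "A \<subseteq> layer X k" "finite A" and c: "card A = card I"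
  shows "sum set_encode I \<le> sum set_encode A \<and> (sum set_encode I = sum set_encode A \<longrightarrow> A = I)"
proof (cases "A = I")
  case False
  have fI: "finite I" "I \<subseteq> layer X k" using I by (auto simp: initial_def)
  have cd: "card (I - A) = card (A - I)"
    using c A fI by (simp add: card_Diff_subset_Int Int_commute)
  have "I - A \<noteq> {}" using False cd A fI
    by (metis Diff_eq_empty_iff card_0_eq finite_Diff card.empty subset_antisym)
  then obtain h where h: "bij_betw h (I - A) (A - I)"
    using finite_same_card_bij[OF _ _ cd] A fI by auto
  have lt: "set_encode S < set_encode (h S)" if "S \<in> I - A" for S
  proof -
    have hS: "h S \<in> A - I" using h that by (auto simp: bij_betw_def)
    have "finite (h S)" "finite S" "h S \<noteq> S" using hS that fI A by (auto simp: layer_def)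
    hence "set_encode (h S) \<noteq> set_encode S" by (simp add: set_encode_eq)
    moreover have "\<not> set_encode (h S) < set_encode S"
      using hS that I A by (auto simp: initial_def)
    ultimately show ?thesis by simp
  qed
  have "sum set_encode (I - A) < (\<Sum>S\<in>I - A. set_encode (h S))"
    by (rule sum_strict_mono) (use lt fI \<open>I - A \<noteq> {}\<close> in auto)
  also have "\<dots> = sum set_encode (A - I)" by (rule sum.reindex_bij_betw[OF h])
  finally have "sum set_encode (I - A) < sum set_encode (A - I)" .
  moreover have "sum set_encode I = sum set_encode (I \<inter> A) + sum set_encode (I - A)"
    using fI by (simp add: sum.Int_Diff)
  moreover have "sum set_encode A = sum set_encode (I \<inter> A) + sum set_encode (A - I)"
    using A by (simp add: sum.Int_Diff[of A set_encode I] Int_commute)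
  ultimately show ?thesis by simp
qed simp

text \<open>The weight of \<open>x\<close> enters only through the size of the link, so replacing
  the parts by families of equal sizes changes the potential only through their own sums.\<close>

lemma sum_link_del:
  assumes "F \<subseteq> layer X k" "finite F"
  shows "sum set_encode F =
    sum set_encode (link x F) + card (link x F) * 2 ^ x + sum set_encode (del x F)"
proof -
  have fin: "finite S" if "S \<in> link x F" for S
    using that assms(1) by (auto simp: link_def layer_def)
  have "sum set_encode F = sum set_encode (insert x ` link x F) + sum set_encode (del x F)"
    by (subst link_del_decomp[of F x], rule sum.union_disjoint) (use assms in \<open>auto simp: del_def\<close>)
  also have "sum set_encode (insert x ` link x F) = (\<Sum>S\<in>link x F. set_encode (insert x S))"
    by (subst sum.reindex) (auto intro: inj_on_subset[OF inj_on_insert] simp: link_def)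
  also have "\<dots> = (\<Sum>S\<in>link x F. 2 ^ x + set_encode S)"
    by (rule sum.cong) (use fin in \<open>auto simp: link_def\<close>)
  also have "\<dots> = sum set_encode (link x F) + card (link x F) * 2 ^ x"
    by (simp add: sum.distrib)
  finally show ?thesis .
qed

text \<open>If all links and deletions of a family are initial segments, but the family is not, then the
  only inversions pair a set with its complement, and there is at most one of them.\<close>

lemma compressed_swap:
  assumes X: "finite X" and C: "C \<subseteq> layer X k"
    and comp: "\<And>x. x \<in> X \<Longrightarrow> initial (X - {x}) (k - 1) (link x C)"
              "\<And>x. x \<in> X \<Longrightarrow> initial (X - {x}) k (del x C)"
  shows "\<exists>I. initial X k I \<and> card I = card C \<and> card (shadow I) \<le> card (shadow C)"
proof (cases "initial X k C")
  case False
  have fC: "finite C" using C X finite_subset finite_layer by blast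
  \<comment> \<open>A common point of \<open>S\<close> and \<open>T\<close> would give an inversion
    in a link, a point of \<open>X\<close> missing from both an inversion in a deletion.\<close>
  have bad: "S = X - T" if S: "S \<in> layer X k" "S \<notin> C" and T: "T \<in> C"
    and lt: "set_encode S < set_encode T" for S T
  proof -
    have TX: "T \<in> layer X k" using T C by auto
    have fin: "finite S" "finite T" using S TX by (auto simp: layer_def)
    have "\<not> (x \<in> S \<and> x \<in> T)" if x: "x \<in> X" for x
    proof
      assume xx: "x \<in> S \<and> x \<in> T"
      have "set_encode S = 2 ^ x + set_encode (S - {x})" "set_encode T = 2 ^ x + set_encode (T - {x})"
        using xx fin set_encode_insert[of "S - {x}" x] set_encode_insert[of "T - {x}" x]
        by (simp_all add: insert_absorb)
      hence "set_encode (S - {x}) < set_encode (T - {x})" using lt by simp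
      moreover have "S - {x} \<in> layer (X - {x}) (k - 1)" using S xx by (auto simp: layer_def)
      moreover have "T - {x} \<in> link x C" using T xx by (auto simp: link_def insert_absorb)
      ultimately have "S - {x} \<in> link x C" using comp(1)[OF x] by (auto simp: initial_def)
      thus False using S xx by (auto simp: link_def insert_absorb)
    qed
    moreover have "x \<in> S \<or> x \<in> T" if x: "x \<in> X" for x
    proof (rule ccontr)
      assume xx: "\<not> (x \<in> S \<or> x \<in> T)"
      have "S \<in> layer (X - {x}) k" "T \<in> del x C" using S T xx by (auto simp: layer_def del_def)
      hence "S \<in> del x C" using comp(2)[OF x] lt by (auto simp: initial_def)
      thus False using S by (auto simp: del_def)
    qed
    ultimately show ?thesis using S TX by (auto simp: layer_def)
  qed
  obtain S T where S: "S \<in> layer X k" "S \<notin> C" and T: "T \<in> C" and lt: "set_encode S < set_encode T"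
    using False C fC by (auto simp: initial_def)
  have ST: "S = X - T" and TX: "T \<in> layer X k" using bad[OF S T lt] T C by auto
  \<comment> \<open>A second inversion crosses the first: \<open>V\<close> precedes
    \<open>T\<close>, or \<open>S\<close> precedes \<open>U\<close>. The crossing pair is an
    inversion too, hence complementary, and this forces both inversions to agree.\<close>
  have uniq: "V = S \<and> U = T" if "V \<in> layer X k" "V \<notin> C" "U \<in> C" "set_encode V < set_encode U" for U V
  proof -
    have VU: "V = X - U" using bad that by blast
    have UX: "U \<in> layer X k" using that C by auto
    show ?thesis
    proof (cases "set_encode V < set_encode T")
      case True
      hence "V = X - T" using bad that T by blast
      thus ?thesis using VU ST UX TX by (auto simp: layer_def)
    next
      case False
      hence "set_encode S < set_encode U" using lt that by linarith
      hence "S = X - U" using bad S that by blast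
      thus ?thesis using VU ST UX TX by (auto simp: layer_def)
    qed
  qed
  define I where "I = insert S (C - {T})"
  have "V \<in> I" if U: "U \<in> I" and V: "V \<in> layer X k" and VU: "set_encode V < set_encode U" for U V
  proof (rule ccontr)
    assume "V \<notin> I"
    hence V': "V \<noteq> S" "V \<notin> C \<or> V = T" by (auto simp: I_def)
    show False
    proof (cases "U = S")
      case True
      thus False using V' V VU uniq[OF V _ T] lt by auto
    next
      case False
      hence "U \<in> C" "U \<noteq> T" using U by (auto simp: I_def)
      thus False using V' V VU uniq[OF V _ \<open>U \<in> C\<close>] uniq[OF S \<open>U \<in> C\<close>] lt by auto
    qed
  qed
  hence init: "initial X k I" using C S fC by (auto simp: initial_def I_def)
  have fin: "finite S" "finite T" and cS: "card S = k" "card T = k" using S TX by (auto simp: layer_def)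
  have cI: "card I = card C" using S card_Suc_Diff1[OF fC T] fC
    by (simp add: I_def del: card_Diff_insert)
  obtain m where m: "m \<in> T" "m \<notin> S" "\<And>i. i > m \<Longrightarrow> i \<in> S \<longleftrightarrow> i \<in> T"
    using lt fin by (auto simp: set_encode_less_iff)
  \<comment> \<open>Complementary sets agree at no point of \<open>X\<close>, so nothing in
    \<open>X\<close> lies above \<open>m\<close>.\<close>
  have top: "i < m" if "i \<in> X" "i \<noteq> m" for i
    using that m(3)[of i] ST TX by (auto simp: layer_def nat_neq_iff)
  \<comment> \<open>The swap adds nothing to the shadow. If \<open>k = 1\<close>, both sets leave
    the empty set. Otherwise \<open>s\<close> is replaced by a point \<open>y\<close> of
    \<open>T\<close> other than \<open>m\<close>; the result precedes \<open>T\<close> and is not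
    \<open>S\<close>, so it lies in \<open>C\<close>, and removing \<open>y\<close> gives the wanted
    set.\<close>
  have "S - {s} \<in> shadow C" if s: "s \<in> S" for s
  proof (cases "k = 1")
    case True
    hence "S - {s} = T - {m}" using cS s m(1) by (metis card_1_singletonE Diff_cancel singletonD)
    thus ?thesis using shadowI[OF T m(1)] by simp
  next
    case False
    have "k \<noteq> 0" using cS s fin by (auto simp: card_gt_0_iff)
    hence "card (T - {m}) \<noteq> 0" using False cS m(1) by simp
    then obtain y where y: "y \<in> T" "y \<noteq> m" using fin by (metis Diff_iff all_not_in_conv card.empty singletonI)
    let ?V = "insert y (S - {s})"
    have yX: "y \<in> X" "y \<notin> S" using y TX ST by (auto simp: layer_def)
    have V: "?V \<in> layer X k" using S s yX fin by (auto simp: layer_def card_gt_0_iff)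
        (metis Suc_pred card_gt_0_iff empty_iff)
    have "i \<notin> ?V \<and> i \<notin> T" if "i > m" for i
      using that top[of i] V TX by (auto simp: layer_def)
    hence "set_encode ?V < set_encode T"
      using m y fin by (subst set_encode_less_iff) (auto intro!: exI[of _ m])
    hence "?V \<in> C" using uniq[OF V _ T] yX by blast
    thus ?thesis using yX by (auto intro: shadow_insertI)
  qed
  hence "shadow I \<subseteq> shadow C" by (auto simp: I_def shadow_def)
  hence "card (shadow I) \<le> card (shadow C)" using C fC by (intro card_mono) auto
  thus ?thesis using init cI by blast
qed auto

text \<open>Induction on the ground set by compression: at each point the link and the deletion are
  replaced by initial segments of the same sizes, which does not enlarge the shadow.\<close>

lemma kruskal_katona:
  assumes "finite X" "A \<subseteq> layer X k"
  shows "\<exists>I. initial X k I \<and> card I = card A \<and> card (shadow I) \<le> card (shadow A)"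
  using assms
proof (induction "card X" arbitrary: X A k rule: less_induct)
  case less
  note X = \<open>finite X\<close> and A = \<open>A \<subseteq> layer X k\<close>
  show ?case
  proof (cases "k = 0")
    case True
    have "initial X k A" using A X finite_subset[OF A]
      by (auto simp: True layer_def initial_def)
    thus ?thesis by blast
  next
    case False
    define Q where "Q B \<longleftrightarrow> B \<subseteq> layer X k \<and> card B = card A \<and> card (shadow B) \<le> card (shadow A)" for B
    \<comment> \<open>A family of least potential among those with shadow no larger than that of
      \<open>A\<close>; compression cannot change it.\<close>
    define C where "C = arg_min (sum set_encode) Q"
    have "Q A" using A by (simp add: Q_def)
    hence QC: "Q C" unfolding C_def by (rule arg_min_natI)
    have Cmin: "sum set_encode C \<le> sum set_encode B" if "Q B" for B
      unfolding C_def using that by (rule arg_min_nat_le)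
    have C: "C \<subseteq> layer X k" using QC by (simp add: Q_def)
    have fC: "finite C" using C X finite_subset finite_layer by blast
    have "initial (X - {x}) (k - 1) (link x C) \<and> initial (X - {x}) k (del x C)" if x: "x \<in> X" for x
    proof -
      have cX: "card (X - {x}) < card X" using X x by (rule card_Diff1_less)
      note l = link_layer[OF C, of x] and d = del_layer[OF C, of x]
      obtain I1 where I1: "initial (X - {x}) (k - 1) I1" "card I1 = card (link x C)"
        "card (shadow I1) \<le> card (shadow (link x C))"
        using less.hyps[OF cX _ l] X by blast
      obtain I0 where I0: "initial (X - {x}) k I0" "card I0 = card (del x C)"
        "card (shadow I0) \<le> card (shadow (del x C))"
        using less.hyps[OF cX _ d] X by blast
      define B where "B = insert x ` I1 \<union> I0"
      have sub: "I1 \<subseteq> layer (X - {x}) (k - 1)" "I0 \<subseteq> layer (X - {x}) k" "finite I1" "finite I0"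
        using I1 I0 by (auto simp: initial_def)
      have B: "B \<subseteq> layer X k" unfolding B_def by (rule glue_layer) (use sub x False in auto)
      have fB: "finite B" using sub by (simp add: B_def)
      have lB: "link x B = I1" and dB: "del x B = I0"
        unfolding B_def by (rule link_glue del_glue; use sub in \<open>auto simp: layer_def\<close>)+
      have cB: "card B = card C" using card_link_del[OF fB, of x] card_link_del[OF fC, of x]
        by (simp add: lB dB I1 I0)
      \<comment> \<open>Both families are initial in the same layer, hence nested, so their union is
        as small as the sizes permit.\<close>
      have "card (I1 \<union> shadow I0) = max (card I1) (card (shadow I0))"
        by (rule initial_card_Un[OF I1(1)], rule initial_shadow[OF I0(1)]) (use False in auto)
      also have "\<dots> \<le> max (card (link x C)) (card (shadow (del x C)))"
        using I1 I0 by auto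
      also have "\<dots> \<le> card (link x C \<union> shadow (del x C))"
        by (intro max.boundedI card_mono) (use fC finite_shadow[OF d] in auto)
      finally have "card (shadow B) \<le> card (shadow C)"
        using card_shadow[OF B fB, of x] card_shadow[OF C fC, of x] I1(3) by (simp add: lB dB)
      hence "Q B" using QC B cB by (simp add: Q_def)
      hence "sum set_encode C \<le> sum set_encode B" by (rule Cmin)
      moreover have "sum set_encode I1 \<le> sum set_encode (link x C) \<and>
          (sum set_encode I1 = sum set_encode (link x C) \<longrightarrow> link x C = I1)"
        by (rule initial_sum_le[OF I1(1)]) (use l fC I1 in auto)
      moreover have "sum set_encode I0 \<le> sum set_encode (del x C) \<and>
          (sum set_encode I0 = sum set_encode (del x C) \<longrightarrow> del x C = I0)"
        by (rule initial_sum_le[OF I0(1)]) (use d fC I0 in auto)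
      \<comment> \<open>The potential cannot have dropped, so both parts were initial segments
        already.\<close>
      ultimately have "link x C = I1" "del x C = I0"
        using sum_link_del[OF B fB, of x] sum_link_del[OF C fC, of x] I1(2)
        by (auto simp: lB dB)
      thus ?thesis using I1 I0 by simp
    qed
    hence "\<exists>I. initial X k I \<and> card I = card C \<and> card (shadow I) \<le> card (shadow C)"
      by (intro compressed_swap[OF X C]) auto
    thus ?thesis using QC unfolding Q_def by (metis order_trans)
  qed
qed

lemma kruskal_katona_UNIV:
  fixes F :: "nat set set"
  assumes "finite F" "F \<subseteq> layer UNIV k"
  obtains I where "initial UNIV k I" "card I = card F" "card (shadow I) \<le> card (shadow F)"
proof -
  have "finite (\<Union>F)" using assms by (auto simp: layer_def)
  then obtain N where "\<Union>F \<subseteq> {..<N}" by (auto simp: finite_nat_set_iff_bounded)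
  hence "F \<subseteq> layer {..<N} k" using assms(2) by (auto simp: layer_def)
  from kruskal_katona[OF finite_lessThan this] show ?thesis
    using that initial_lessThan_UNIV by blast
qed

section \<open>Moving families between ground sets\<close>

lemma image_family:
  assumes g: "inj_on g X" and F: "F \<subseteq> layer X k"
  shows "(`) g ` F \<subseteq> layer (g ` X) k" "card ((`) g ` F) = card F"
    "shadow ((`) g ` F) = (`) g ` shadow F" "card (shadow ((`) g ` F)) = card (shadow F)"
proof -
  have sub: "S \<subseteq> X" "finite S" "card S = k" if "S \<in> F" for S using that F by (auto simp: layer_def)
  have inj: "inj_on ((`) g) (Pow X)" using g by (simp add: inj_on_image_Pow)
  have "card (g ` S) = k" if "S \<in> F" for S
    using sub[OF that] g by (metis card_image inj_on_subset)
  thus "(`) g ` F \<subseteq> layer (g ` X) k" using sub by (auto simp: layer_def)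
  show "card ((`) g ` F) = card F"
    by (rule card_image, rule inj_on_subset[OF inj]) (use sub in auto)
  have diff: "g ` S - {g x} = g ` (S - {x})" if "S \<in> F" "x \<in> S" for S x
    using that sub[OF that(1)] g by (auto dest: inj_onD)
  show sh: "shadow ((`) g ` F) = (`) g ` shadow F"
  proof
    show "shadow ((`) g ` F) \<subseteq> (`) g ` shadow F"
    proof
      fix U assume "U \<in> shadow ((`) g ` F)"
      then obtain S x where S: "S \<in> F" "x \<in> S" "U = g ` S - {g x}" by (auto simp: shadow_def)
      thus "U \<in> (`) g ` shadow F" using diff[OF S(1,2)]
        by (intro image_eqI[OF _ shadowI[OF S(1,2)]]) simp
    qed
    show "(`) g ` shadow F \<subseteq> shadow ((`) g ` F)"
    proof
      fix U assume "U \<in> (`) g ` shadow F"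
      then obtain S x where S: "S \<in> F" "x \<in> S" "U = g ` (S - {x})" by (auto simp: shadow_def)
      thus "U \<in> shadow ((`) g ` F)"
        using shadowI[of "g ` S" "(`) g ` F" "g x"] diff[OF S(1,2)] by simp
    qed
  qed
  show "card (shadow ((`) g ` F)) = card (shadow F)"
    unfolding sh by (rule card_image, rule inj_on_subset[OF inj]) (use sub in \<open>auto simp: shadow_def\<close>)
qed

text \<open>Initial segments of equal size coincide, so the optimal family of a given size lives on
  \<open>{..<card Y}\<close> once enough \<open>k\<close>-sets exist there; a bijection carries it
  to \<open>Y\<close>.\<close>

lemma shadow_compress_into:
  fixes F :: "nat set set"
  assumes F: "finite F" "F \<subseteq> layer UNIV k" and Y: "finite Y" "card F \<le> card Y choose k"
  obtains R where "R \<subseteq> layer Y k" "card R = card F" "card (shadow R) \<le> card (shadow F)"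
proof -
  obtain I where I: "initial UNIV k I" "card I = card F" "card (shadow I) \<le> card (shadow F)"
    using kruskal_katona_UNIV[OF F] .
  obtain J where J: "initial {..<card Y} k J" "card J = card F"
    using initial_exists[of "{..<card Y}" "card F" k] Y by auto
  have "initial UNIV k J" using J(1) by (rule initial_lessThan_UNIV)
  moreover have "finite I" "finite J" using I J by (auto simp: initial_def)
  ultimately have "I = J" using initial_nested[OF I(1)] I(2) J(2) by (metis card_subset_eq)
  obtain g where g: "bij_betw g {..<card Y} Y"
    using ex_bij_betw_nat_finite[OF Y(1)] by (auto simp: lessThan_atLeast0)
  have JY: "J \<subseteq> layer {..<card Y} k" using J by (simp add: initial_def)
  have gi: "inj_on g {..<card Y}" "g ` {..<card Y} = Y" using g by (auto simp: bij_betw_def)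
  show ?thesis
    by (rule that[of "(`) g ` J"])
      (use image_family[OF gi(1) JY] gi(2) I \<open>I = J\<close> in auto)
qed

section \<open>Families with minimal shadow\<close>

text \<open>Competitors range over all finite families of naturals, so the notion mentions no ground
  set and can pass to links and deletions. By Kruskal-Katona this agrees with minimality inside any
  finite ground set of the family.\<close>

definition shadow_minimal :: "nat \<Rightarrow> nat set set \<Rightarrow> bool" where
  "shadow_minimal k F \<longleftrightarrow> finite F \<and> F \<subseteq> layer UNIV k \<and>
     (\<forall>G :: nat set set. finite G \<and> G \<subseteq> layer UNIV k \<and> card G = card F \<longrightarrow> card (shadow F) \<le> card (shadow G))"

text \<open>Initial segments with a fresh point glued to those of smaller degree attain the bound, because
  the two initial segments being united are nested.\<close>

lemma combine_families:
  fixes H1 H0 :: "nat set set"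
  assumes H1: "finite H1" "H1 \<subseteq> layer UNIV (k - 1)" and H0: "finite H0" "H0 \<subseteq> layer UNIV k"
    and k: "k \<ge> 1"
  obtains G :: "nat set set" where "finite G" "G \<subseteq> layer UNIV k" "card G = card H1 + card H0"
    "card (shadow G) \<le> card (shadow H1) + max (card H1) (card (shadow H0))"
proof -
  obtain I1 where I1: "initial UNIV (k - 1) I1" "card I1 = card H1" "card (shadow I1) \<le> card (shadow H1)"
    using kruskal_katona_UNIV[OF H1] .
  obtain I0 where I0: "initial UNIV k I0" "card I0 = card H0" "card (shadow I0) \<le> card (shadow H0)"
    using kruskal_katona_UNIV[OF H0] .
  have fin: "finite I1" "finite I0" and sub: "I1 \<subseteq> layer UNIV (k - 1)" "I0 \<subseteq> layer UNIV k"
    using I1 I0 by (auto simp: initial_def)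
  have "finite (\<Union>(I1 \<union> I0))" using fin sub by (auto simp: layer_def)
  then obtain x where x: "x \<notin> \<Union>(I1 \<union> I0)" using ex_new_if_finite[OF infinite_UNIV_nat] by blast
  define G where "G = insert x ` I1 \<union> I0"
  have l: "link x G = I1" and d: "del x G = I0"
    unfolding G_def by (rule link_glue del_glue; use x in auto)+
  have G: "G \<subseteq> layer UNIV k" "finite G" unfolding G_def
    by (rule glue_layer) (use x sub k fin in \<open>auto simp: layer_def\<close>)
  have "card (I1 \<union> shadow I0) = max (card I1) (card (shadow I0))"
    by (rule initial_card_Un[OF I1(1) initial_shadow[OF I0(1) k]])
  hence "card (shadow G) \<le> card (shadow H1) + max (card H1) (card (shadow H0))"
    using card_shadow[OF G, of x] I1 I0 by (auto simp: l d)
  moreover have "card G = card H1 + card H0"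
    using card_link_del[OF G(2), of x] I1 I0 by (simp add: l d)
  ultimately show ?thesis using that G by blast
qed

text \<open>If the parts are replaced by \<open>H1\<close> and \<open>H0\<close> of the same sizes,
  \<open>combine_families\<close> gives a competitor whose second summand is only a maximum; hence
  the link is minimal. If the shadow of the deletion is not inside the link, the union exceeds the
  link, so that shadow alone attains the maximum; then the link lies in it and the deletion is
  minimal too.\<close>

lemma shadow_minimal_link_del:
  assumes "shadow_minimal k G" "k \<ge> 1"
  shows "shadow_minimal (k - 1) (link x G)"
    "shadow (del x G) \<subseteq> link x G \<or> link x G \<subseteq> shadow (del x G) \<and> shadow_minimal k (del x G)"
proof -
  have G: "finite G" "G \<subseteq> layer UNIV k"
    and min: "\<And>H :: nat set set. finite H \<Longrightarrow> H \<subseteq> layer UNIV k \<Longrightarrow> card H = card G \<Longrightarrow> card (shadow G) \<le> card (shadow H)"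
    using assms(1) by (auto simp: shadow_minimal_def)
  let ?L = "link x G" and ?D = "del x G"
  have L: "finite ?L" "?L \<subseteq> layer UNIV (k - 1)"
    using order.trans[OF link_layer[OF G(2), of x] layer_mono[OF subset_UNIV]] by (simp_all add: G(1))
  have D: "finite ?D" "?D \<subseteq> layer UNIV k"
    using G by (auto simp: del_def)
  have fS: "finite (shadow ?D)" using D by (rule finite_shadow[rotated])
  have le: "card (shadow ?L) + card (?L \<union> shadow ?D) \<le> card (shadow H1) + max (card H1) (card (shadow H0))"
    if H1: "finite H1" "H1 \<subseteq> layer UNIV (k - 1)" "card H1 = card ?L"
      and H0: "finite H0" "H0 \<subseteq> layer UNIV k" "card H0 = card ?D" for H1 H0 :: "nat set set"
  proof -
    obtain H :: "nat set set" where H: "finite H" "H \<subseteq> layer UNIV k" "card H = card H1 + card H0"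
      "card (shadow H) \<le> card (shadow H1) + max (card H1) (card (shadow H0))"
      using combine_families[OF H1(1,2) H0(1,2) assms(2)] .
    have "card (shadow G) \<le> card (shadow H)"
      using min[OF H(1,2)] H(3) H1 H0 card_link_del[OF G(1), of x] by simp
    thus ?thesis using H(4) card_shadow[OF G(2,1), of x] by simp
  qed
  have Un: "max (card ?L) (card (shadow ?D)) \<le> card (?L \<union> shadow ?D)"
    using L fS by (auto intro: card_mono)
  show "shadow_minimal (k - 1) ?L"
    unfolding shadow_minimal_def
  proof (intro conjI allI impI; (elim conjE)?)
    fix H1 :: "nat set set"
    assume H1: "finite H1" "H1 \<subseteq> layer UNIV (k - 1)" "card H1 = card ?L"
    show "card (shadow ?L) \<le> card (shadow H1)"
      using le[OF H1 D refl] Un H1(3) by linarith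
  qed (use L in auto)
  have Un_le: "card (?L \<union> shadow ?D) \<le> max (card ?L) (card (shadow H0))"
    if "finite H0" "H0 \<subseteq> layer UNIV k" "card H0 = card ?D" for H0 :: "nat set set"
    using le[OF L refl that] by simp
  show "shadow ?D \<subseteq> ?L \<or> ?L \<subseteq> shadow ?D \<and> shadow_minimal k ?D"
  proof (cases "shadow ?D \<subseteq> ?L")
    case False
    hence lt: "card ?L < card (?L \<union> shadow ?D)" using L fS by (intro psubset_card_mono) auto
    hence eq: "card (?L \<union> shadow ?D) = card (shadow ?D)"
      using Un_le[OF D refl] Un by linarith
    hence "shadow ?D = ?L \<union> shadow ?D" using L fS by (intro card_subset_eq) auto
    moreover have "card (shadow ?D) \<le> card (shadow H0)"
      if "finite H0" "H0 \<subseteq> layer UNIV k" "card H0 = card ?D" for H0 :: "nat set set"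
      using Un_le[OF that] lt eq by linarith
    hence "shadow_minimal k ?D" using D by (simp add: shadow_minimal_def)
    ultimately show ?thesis by blast
  qed simp
qed

text \<open>Two families of \<open>j\<close>-sets can be moved so that their ground sets share a single \<open>(j - 1)\<close>-set,
  which lies in both shadows. The families are then still disjoint.\<close>

lemma shadow_strict_subadditive:
  fixes P Q :: "nat set set"
  assumes P: "finite P" "P \<subseteq> layer UNIV j" "P \<noteq> {}" and Q: "finite Q" "Q \<subseteq> layer UNIV j" "Q \<noteq> {}"
    and j: "j \<ge> 1" and Y: "finite Y" "card P + card Q \<le> card Y choose j"
  obtains R where "R \<subseteq> layer Y j" "card R = card P + card Q"
    "card (shadow R) < card (shadow P) + card (shadow Q)"
proof -
  obtain S T where S: "S \<in> P" and T: "T \<in> Q" using P Q by blast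
  have fS: "finite S" "card S = j" and fT: "finite T" "card T = j"
    using S T P Q by (auto simp: layer_def)
  obtain s t where s: "s \<in> S" and t: "t \<in> T" using fS fT j by fastforce
  have "card (T - {t}) = card (S - {s})" using fS fT s t by simp
  then obtain h where h: "bij_betw h (T - {t}) (S - {s})"
    using finite_same_card_bij fS fT by (metis finite_Diff)
  have "finite (\<Union>P)" using P by (auto simp: layer_def)
  then obtain N where N: "\<Union>P \<subseteq> {..<N}" by (auto simp: finite_nat_set_iff_bounded)
  \<comment> \<open>\<open>g\<close> identifies \<open>T - {t}\<close> with \<open>S - {s}\<close>
    and pushes all other points beyond the ground set of \<open>P\<close>.\<close>
  define g where "g i = (if i \<in> T - {t} then h i else i + N)" for i
  have hN: "h i < N" if "i \<in> T - {t}" for i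
  proof -
    have "h i \<in> S - {s}" by (rule bij_betw_apply[OF h that])
    hence "h i \<in> \<Union>P" using S by blast
    thus ?thesis using N by auto
  qed
  have inj: "inj_on g UNIV"
  proof (rule injI)
    fix a b assume ab: "g a = g b"
    show "a = b"
    proof (cases "a \<in> T - {t} \<longleftrightarrow> b \<in> T - {t}")
      case True
      thus ?thesis using ab bij_betw_imp_inj_on[OF h]
        by (cases "a \<in> T - {t}") (auto simp: g_def inj_on_def)
    next
      case False
      thus ?thesis using ab hN[of a] hN[of b] by (auto simp: g_def split: if_splits)
    qed
  qed
  define Q' where "Q' = (`) g ` Q"
  note im = image_family[OF inj Q(2), folded Q'_def]
  have Q': "finite Q'" "Q' \<subseteq> layer UNIV j"
    using Q im(1) layer_mono[of "range g" UNIV j] by (auto simp: Q'_def)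
  \<comment> \<open>A set of \<open>Q\<close> moved into \<open>P\<close> would have all its points
    in \<open>T - {t}\<close>, which has only \<open>j - 1\<close> of them.\<close>
  have disj: "P \<inter> Q' = {}"
  proof (rule ccontr)
    assume "P \<inter> Q' \<noteq> {}"
    then obtain U where U: "U \<in> Q" "g ` U \<in> P" by (auto simp: Q'_def)
    have "i \<in> T - {t}" if "i \<in> U" for i
    proof (rule ccontr)
      assume "i \<notin> T - {t}"
      hence "g i = i + N" unfolding g_def by (rule if_not_P)
      moreover have "g i \<in> \<Union>P" using U(2) that by blast
      ultimately show False using N by auto
    qed
    hence "card U \<le> card (T - {t})" using fT by (intro card_mono) auto
    thus False using U Q fT t j by (auto simp: layer_def)
  qed
  have "g ` (T - {t}) = S - {s}" using h by (auto simp: g_def bij_betw_def)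
  hence "S - {s} \<in> shadow P \<inter> shadow Q'"
    using shadowI[OF S s] imageI[OF shadowI[OF T t], of "(`) g"] im(3) by simp
  moreover have fsh: "finite (shadow P)" "finite (shadow Q')"
    using finite_shadow[OF P(2,1)] finite_shadow[OF Q'(2,1)] by auto
  ultimately have "card (shadow P \<inter> shadow Q') > 0" by (auto simp: card_gt_0_iff)
  hence "card (shadow P \<union> shadow Q') < card (shadow P) + card (shadow Q')"
    using card_Un_Int[OF fsh] by simp
  hence lt: "card (shadow (P \<union> Q')) < card (shadow P) + card (shadow Q)"
    using im(4) by (simp add: shadow_Un)
  have "card (P \<union> Q') = card P + card Q" using card_Un_disjoint[OF P(1) Q'(1) disj] im(2) by simp
  moreover obtain R where "R \<subseteq> layer Y j" "card R = card (P \<union> Q')" "card (shadow R) \<le> card (shadow (P \<union> Q'))"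
    using shadow_compress_into[of "P \<union> Q'" j Y] P Q' Y calculation by auto
  ultimately show ?thesis using that lt by simp
qed

text \<open>Moving the sets through \<open>x\<close> into the star of \<open>y\<close>, whose deletion is already full, glues two
  nonempty families together and so makes the shadow strictly smaller.\<close>

lemma not_shadow_minimal:
  fixes X :: "nat set"
  assumes X: "finite X" "x \<in> X" and G: "G \<subseteq> layer X k" and k: "k \<ge> 1"
    and L: "link x G \<noteq> {}" "link x G \<subseteq> shadow (del x G)"
    and full: "layer (X - {x} - {y}) k \<subseteq> del x G" and P: "link y (del x G) \<noteq> {}"
    and card_le: "card G \<le> card X - 1 choose k"
  shows "\<not> shadow_minimal k G"
proof
  assume min: "shadow_minimal k G"
  define Z where "Z = X - {x} - {y}"
  define n where "n = card Z"
  let ?L = "link x G" and ?D = "del x G" and ?P = "link y (del x G)"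
  have fin: "finite G" "finite Z" using X finite_subset[OF G] by (auto simp: Z_def)
  have D: "?D \<subseteq> layer (X - {x}) k" "finite ?D" using del_layer[OF G] fin by auto
  obtain S where "insert y S \<in> ?D" using P by (auto simp: link_def)
  hence y: "y \<in> X - {x}" using D(1) by (auto simp: layer_def)
  have cX: "card X - 1 = Suc n"
    using card_Suc_Diff1[of "X - {x}" y] card_Diff_singleton[OF X(2)] X(1) y by (simp add: n_def Z_def)
  have dD: "del y ?D = layer Z k"
  proof
    show "del y ?D \<subseteq> layer Z k" using del_layer[OF D(1)] by (simp add: Z_def)
    show "layer Z k \<subseteq> del y ?D" using full by (auto simp: Z_def del_def layer_def)
  qed
  have P': "?P \<subseteq> layer Z (k - 1)" "finite ?P" using link_layer[OF D(1)] D by (auto simp: Z_def)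
  have L': "?L \<subseteq> layer (X - {x}) (k - 1)" "finite ?L" using link_layer[OF G] fin by auto
  have cG: "card G = card ?L + card ?P + (n choose k)"
    using card_link_del[OF fin(1), of x] card_link_del[OF D(2), of y] card_layer[OF fin(2)]
    by (simp add: dD n_def)
  have pos: "card ?L > 0" "card ?P > 0" using L P L' P' by (auto simp: card_gt_0_iff)
  have "Suc n choose k = (n choose (k - 1)) + (n choose k)"
    using k by (cases k) auto
  \<comment> \<open>By Pascal's rule, once the full deletion is subtracted, the links at
    \<open>x\<close> and at \<open>y\<close> together fit among the \<open>(k - 1)\<close>-subsets
    of \<open>Z\<close>. Both are nonempty, which excludes the degrees with at most one such
    subset.\<close>
  hence le: "card ?P + card ?L \<le> n choose (k - 1)" using card_le cX cG by simp
  have k1: "k - 1 \<ge> 1"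
  proof (rule ccontr)
    assume "\<not> ?thesis"
    hence "n choose (k - 1) = 1" by simp
    thus False using le pos by simp
  qed
  have kn: "k - 1 < n"
  proof (rule ccontr)
    assume "\<not> ?thesis"
    hence "n choose (k - 1) \<le> 1" by (cases "k - 1 = n") (auto simp: binomial_eq_0)
    thus False using le pos by simp
  qed
  have sh: "layer Z (k - 1) \<subseteq> shadow (layer Z k)"
  proof
    fix T assume T: "T \<in> layer Z (k - 1)"
    hence "T \<noteq> Z" using kn by (auto simp: layer_def n_def)
    then obtain z where "z \<in> Z" "z \<notin> T" using T by (auto simp: layer_def)
    moreover from this have "insert z T \<in> layer Z k" using T k by (auto simp: layer_def)
    ultimately show "T \<in> shadow (layer Z k)" by (auto intro: shadow_insertI)
  qed
  have "?P \<subseteq> layer UNIV (k - 1)" "?L \<subseteq> layer UNIV (k - 1)"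
    using P'(1) L'(1) by (auto simp: layer_def)
  then obtain R where R: "R \<subseteq> layer Z (k - 1)" "card R = card ?P + card ?L"
    "card (shadow R) < card (shadow ?P) + card (shadow ?L)"
    using shadow_strict_subadditive[of ?P "k - 1" ?L Z] P P' L L' k1 fin le by (auto simp: n_def)
  have fR: "finite R" using R(1) fin finite_subset finite_layer by blast
  \<comment> \<open>The competitor has no set through \<open>x\<close>: the merged family becomes
    its link at \<open>y\<close>, next to the full deletion.\<close>
  define H where "H = insert y ` R \<union> layer Z k"
  have lH: "link y H = R" and dH: "del y H = layer Z k"
    unfolding H_def by (rule link_glue del_glue; use R in \<open>auto simp: layer_def Z_def\<close>)+
  have H: "H \<subseteq> layer (X - {x}) k" "finite H"
    unfolding H_def using glue_layer[of R "X - {x}" y k "layer Z k"] R y k fin fR by (auto simp: Z_def)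
  have "card H = card G"
    using card_link_del[OF H(2), of y] card_layer[OF fin(2)] R(2) by (simp add: lH dH cG n_def)
  moreover have "H \<subseteq> layer UNIV k" using H by (auto simp: layer_def)
  ultimately have "card (shadow G) \<le> card (shadow H)"
    using min H by (auto simp: shadow_minimal_def)
  also have "card (shadow H) = card (shadow R) + card (R \<union> shadow (layer Z k))"
    using card_shadow[OF H, of y] by (simp add: lH dH)
  \<comment> \<open>Shadow sets without \<open>y\<close>: for \<open>H\<close> they all lie in
    \<open>layer Z (k - 1)\<close>, and that whole layer already occurs for \<open>?D\<close>. The
    strict gain in the links decides.\<close>
  also have "card (R \<union> shadow (layer Z k)) \<le> card (layer Z (k - 1))"
    by (rule card_mono) (use fin R shadow_layer[of "layer Z k" Z k] in auto)
  also have "card (layer Z (k - 1)) \<le> card (?P \<union> shadow (del y ?D))"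
    by (rule card_mono) (use P' sh D fin finite_shadow[of "layer Z k" Z k] in \<open>auto simp: dD\<close>)
  also have "card (shadow R) + card (?P \<union> shadow (del y ?D)) < card (shadow ?L) + card (shadow ?D)"
    using R(3) card_shadow[OF D, of y] by simp
  also have "card (shadow ?D) \<le> card (?L \<union> shadow ?D)"
    by (rule card_mono) (use L' finite_shadow[OF D] in auto)
  also have "card (shadow ?L) + card (?L \<union> shadow ?D) = card (shadow G)"
    using card_shadow[OF G fin(1), of x] by simp
  finally show False by simp
qed

section \<open>Families minimal on both sides\<close>

text \<open>Both conditions concern lower shadows. The one on the missing sets encodes the
  Gotzmann-dual property; the one on the complemented sets encodes the Gotzmann property, since
  complementing sets turns upper shadows into lower ones.\<close>

definition bigotzmann :: "nat set \<Rightarrow> nat \<Rightarrow> nat set set \<Rightarrow> bool" where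
  "bigotzmann X d A \<longleftrightarrow> A \<subseteq> layer X d \<and> shadow_minimal d (layer X d - A) \<and>
     shadow_minimal (card X - d) ((-) X ` A)"

lemma link_layer_eq: "x \<in> X \<Longrightarrow> d \<ge> 1 \<Longrightarrow> link x (layer X d) = layer (X - {x}) (d - 1)"
  by (intro equalityI link_layer[OF subset_refl])
    (auto simp: link_def layer_def card_insert_if subset_Diff_insert)

lemma link_del_layer_Diff:
  assumes "x \<in> X" "d \<ge> 1"
  shows "link x (layer X d - A) = layer (X - {x}) (d - 1) - link x A"
    "del x (layer X d - A) = layer (X - {x}) d - del x A"
proof -
  have "link x (layer X d - A) = link x (layer X d) - link x A" by (auto simp: link_def)
  thus "link x (layer X d - A) = layer (X - {x}) (d - 1) - link x A"
    using link_layer_eq[OF assms] by simp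
qed (auto simp: del_def layer_def)

lemma inj_on_compl: "inj_on ((-) X) (Pow X)"
  by (rule inj_onI) blast

text \<open>Complementation exchanges the two parts, because a set avoids \<open>x\<close> exactly
  when its complement contains it.\<close>

lemma link_compl:
  assumes "A \<subseteq> layer X d" "x \<in> X"
  shows "link x ((-) X ` A) = (-) (X - {x}) ` del x A"
proof
  show "link x ((-) X ` A) \<subseteq> (-) (X - {x}) ` del x A"
  proof
    fix S assume "S \<in> link x ((-) X ` A)"
    then obtain T where T: "x \<notin> S" "insert x S = X - T" "T \<in> A" by (auto simp: link_def)
    hence "S = X - {x} - T" "T \<in> del x A" by (auto simp: del_def)
    thus "S \<in> (-) (X - {x}) ` del x A" by blast
  qed
  show "(-) (X - {x}) ` del x A \<subseteq> link x ((-) X ` A)"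
    using assms by (auto simp: link_def del_def)
qed

lemma del_compl:
  assumes "A \<subseteq> layer X d" "x \<in> X"
  shows "del x ((-) X ` A) = (-) (X - {x}) ` link x A"
proof
  show "del x ((-) X ` A) \<subseteq> (-) (X - {x}) ` link x A"
  proof
    fix S assume "S \<in> del x ((-) X ` A)"
    then obtain T where T: "S = X - T" "T \<in> A" "x \<in> T" using assms by (auto simp: del_def)
    hence "S = X - {x} - (T - {x})" "T - {x} \<in> link x A" by (auto simp: link_def insert_absorb)
    thus "S \<in> (-) (X - {x}) ` link x A" by blast
  qed
  show "(-) (X - {x}) ` link x A \<subseteq> del x ((-) X ` A)"
    using assms by (auto simp: link_def del_def)
qed

text \<open>\<open>shadow_minimal_link_del\<close> applies to both families. Its first alternative
  says in either case that the upper shadow of the link lies in the deletion. If this fails, the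
  second alternative holds twice; since complementation exchanges link and deletion, each part of
  \<open>A\<close> gets one minimality property from a link and one from a deletion.\<close>

lemma bigotzmann_step:
  assumes X: "finite X" "x \<in> X" and d: "0 < d" "d < card X" and A: "bigotzmann X d A"
  shows "(\<forall>S\<in>link x A. \<forall>y\<in>X - {x} - S. insert y S \<in> del x A) \<or>
    bigotzmann (X - {x}) (d - 1) (link x A) \<and> bigotzmann (X - {x}) d (del x A) \<and>
    (-) (X - {x}) ` del x A \<subseteq> shadow ((-) (X - {x}) ` link x A) \<and>
    layer (X - {x}) (d - 1) - link x A \<subseteq> shadow (layer (X - {x}) d - del x A)"
    (is "?closed \<or> _")
proof (cases ?closed)
  case False
  let ?Y = "X - {x}"
  have AX: "A \<subseteq> layer X d" using A by (simp add: bigotzmann_def)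
  note l = link_layer[OF AX, of x] and dl = del_layer[OF AX, of x]
  have 1: "shadow_minimal (d - 1) (layer ?Y (d - 1) - link x A)"
    "shadow (layer ?Y d - del x A) \<subseteq> layer ?Y (d - 1) - link x A \<or>
     layer ?Y (d - 1) - link x A \<subseteq> shadow (layer ?Y d - del x A) \<and> shadow_minimal d (layer ?Y d - del x A)"
    using shadow_minimal_link_del[of d "layer X d - A" x] A d X
    by (simp_all add: bigotzmann_def link_del_layer_Diff)
  have "\<not> shadow (layer ?Y d - del x A) \<subseteq> layer ?Y (d - 1) - link x A"
  proof
    assume sub: "shadow (layer ?Y d - del x A) \<subseteq> layer ?Y (d - 1) - link x A"
    have "insert y S \<in> del x A" if S: "S \<in> link x A" and y: "y \<in> ?Y - S" for S y
    proof (rule ccontr)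
      assume "insert y S \<notin> del x A"
      moreover have "insert y S \<in> layer ?Y d" using S l y d by (auto simp: layer_def)
      ultimately have "S \<in> shadow (layer ?Y d - del x A)" using y by (auto intro: shadow_insertI)
      thus False using sub S by auto
    qed
    thus False using False by blast
  qed
  with 1 have B: "shadow_minimal (d - 1) (layer ?Y (d - 1) - link x A)"
    "layer ?Y (d - 1) - link x A \<subseteq> shadow (layer ?Y d - del x A)" "shadow_minimal d (layer ?Y d - del x A)"
    by auto
  have c: "card ?Y - (d - 1) = card X - d" "card ?Y - d = card X - d - 1" using X d by auto
  have 2: "shadow_minimal (card X - d - 1) ((-) ?Y ` del x A)"
    "shadow ((-) ?Y ` link x A) \<subseteq> (-) ?Y ` del x A \<or>
     (-) ?Y ` del x A \<subseteq> shadow ((-) ?Y ` link x A) \<and> shadow_minimal (card X - d) ((-) ?Y ` link x A)"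
    using shadow_minimal_link_del[of "card X - d" "(-) X ` A" x] A d
    by (simp_all add: bigotzmann_def link_compl[OF AX X(2)] del_compl[OF AX X(2)])
  \<comment> \<open>The same closedness read through complements: removing \<open>y\<close> from the
    complement of \<open>S\<close> is adding \<open>y\<close> to \<open>S\<close>.\<close>
  have "\<not> shadow ((-) ?Y ` link x A) \<subseteq> (-) ?Y ` del x A"
  proof
    assume sub: "shadow ((-) ?Y ` link x A) \<subseteq> (-) ?Y ` del x A"
    have "insert y S \<in> del x A" if S: "S \<in> link x A" and y: "y \<in> ?Y - S" for S y
    proof -
      have "?Y - S - {y} \<in> (-) ?Y ` del x A"
        using sub shadowI[of "?Y - S" "(-) ?Y ` link x A" y] S y by auto
      then obtain T where T: "T \<in> del x A" "?Y - S - {y} = ?Y - T" by auto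
      have TS: "T \<subseteq> ?Y" "S \<subseteq> ?Y" using T(1) S dl l by (auto simp: layer_def)
      have "T = ?Y - (?Y - T)" using double_diff[OF TS(1) subset_refl] by simp
      also have "\<dots> = ?Y - (?Y - S - {y})" by (simp only: T(2))
      also have "\<dots> = insert y S" using TS(2) y by blast
      finally have "T = insert y S" .
      thus ?thesis using T(1) by simp
    qed
    thus False using False by blast
  qed
  with 2 c B l dl show ?thesis by (simp add: bigotzmann_def)
qed simp

text \<open>Any \<open>d\<close>-set can be turned into any other by exchanging one point at a time,
  so one member yields all. This provides a variable at which \<open>bigotzmann_step\<close>
  descends.\<close>

lemma closed_under_exchange:
  assumes X: "finite X" and A: "A \<subseteq> layer X d"
    and ex: "\<And>x S y. x \<in> X \<Longrightarrow> S \<in> link x A \<Longrightarrow> y \<in> X - {x} - S \<Longrightarrow> insert y S \<in> A"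
  shows "A = {} \<or> A = layer X d"
proof -
  have "T \<in> A" if "S \<in> A" "T \<in> layer X d" for S T
    using that
  proof (induction "card (T - S)" arbitrary: S rule: less_induct)
    case less
    have SX: "S \<in> layer X d" using less.prems A by auto
    have fin: "finite S" "finite T" "card S = card T" using SX less.prems by (auto simp: layer_def)
    show ?case
    proof (cases "T \<subseteq> S")
      case True
      hence "T = S" using fin by (metis card_subset_eq)
      thus ?thesis using less.prems by simp
    next
      case False
      then obtain y where y: "y \<in> T" "y \<notin> S" by auto
      have "\<not> S \<subseteq> T" using fin y by (metis card_subset_eq)
      then obtain x where x: "x \<in> S" "x \<notin> T" by auto
      have "S - {x} \<in> link x A" using x less.prems by (auto simp: link_def insert_absorb)
      hence "insert y (S - {x}) \<in> A"
        using ex[of x "S - {x}" y] x y SX less.prems by (auto simp: layer_def)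
      moreover have "card (T - insert y (S - {x})) < card (T - S)"
        by (rule psubset_card_mono) (use fin x y in auto)
      ultimately show ?thesis using less.hyps less.prems by blast
    qed
  qed
  thus ?thesis using A by blast
qed

lemma nontrivial_family_degree:
  assumes X: "finite X" and A: "A \<subseteq> layer X d" "A \<noteq> {}" "A \<noteq> layer X d"
  shows "0 < d" "d < card X"
proof -
  have "d \<noteq> 0" using A by (auto simp: layer_def)
  thus "0 < d" by simp
  show "d < card X"
  proof (rule ccontr)
    assume "\<not> ?thesis"
    hence "S = X" if "S \<in> layer X d" for S
      using that X card_seteq[of X S] by (auto simp: layer_def)
    thus False using A by blast
  qed
qed

section \<open>A star inside or around the family\<close>

text \<open>At a variable \<open>x\<close> where both parts inherit the properties, induction gives
  the dichotomy for the link and for the deletion. The size of \<open>A\<close> decides which of the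
  two is used; the unwanted alternative is excluded by \<open>not_shadow_minimal\<close>.\<close>

lemma star_dichotomy:
  assumes "finite X" "X \<noteq> {}" "bigotzmann X d A"
  shows "\<exists>x\<in>X. (\<forall>S\<in>A. x \<in> S) \<or> (\<forall>S\<in>layer X d. x \<in> S \<longrightarrow> S \<in> A)"
  using assms
proof (induction "card X" arbitrary: X d A rule: less_induct)
  case less
  note X = \<open>finite X\<close> and A = \<open>bigotzmann X d A\<close>
  have AX: "A \<subseteq> layer X d" using A by (simp add: bigotzmann_def)
  show ?case
  proof (cases "A = {} \<or> A = layer X d")
    case True
    thus ?thesis using less.prems(2) by auto
  next
    case False
    have d: "0 < d" "d < card X" using nontrivial_family_degree[OF X AX] False by auto
    have "\<not> (\<forall>x\<in>X. \<forall>S\<in>link x A. \<forall>y\<in>X - {x} - S. insert y S \<in> del x A)"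
      using closed_under_exchange[OF X AX] False by (auto simp: del_def)
    then obtain x where x: "x \<in> X"
      and nx: "\<not> (\<forall>S\<in>link x A. \<forall>y\<in>X - {x} - S. insert y S \<in> del x A)" by blast
    let ?Y = "X - {x}" and ?A1 = "link x A" and ?A0 = "del x A"
    have A1: "bigotzmann ?Y (d - 1) ?A1" and A0: "bigotzmann ?Y d ?A0"
      and up: "(-) ?Y ` ?A0 \<subseteq> shadow ((-) ?Y ` ?A1)"
      and dn: "layer ?Y (d - 1) - ?A1 \<subseteq> shadow (layer ?Y d - ?A0)"
      using bigotzmann_step[OF X x d A] nx by auto
    have Y: "finite ?Y" "card ?Y < card X" "card ?Y = card X - 1"
      using X card_Diff1_less[OF X x] card_Diff_singleton[OF x] by simp_all
    have Yne: "?Y \<noteq> {}"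
    proof -
      have "card ?Y > 0" using Y(3) d by linarith
      thus ?thesis by (metis card.empty less_nat_zero_code)
    qed
    note IH = less.hyps[OF Y(2,1) Yne]
    note l = link_layer[OF AX, of x] and dl = del_layer[OF AX, of x]
    have mem: "S \<in> A \<longleftrightarrow> (if x \<in> S then S - {x} \<in> ?A1 else S \<in> ?A0)" for S
      by (auto simp: link_def del_def insert_absorb)
    \<comment> \<open>The threshold is the number of \<open>d\<close>-sets through one point: an
      upper bound for families inside a star, a lower bound for families containing one.\<close>
    consider "?A0 = {}" | "layer ?Y (d - 1) \<subseteq> ?A1"
      | "?A0 \<noteq> {}" "\<not> layer ?Y (d - 1) \<subseteq> ?A1" "card A \<le> card X - 1 choose (d - 1)"
      | "?A0 \<noteq> {}" "\<not> layer ?Y (d - 1) \<subseteq> ?A1" "card A > card X - 1 choose (d - 1)"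
      by linarith
    thus ?thesis
    proof cases
      case 1
      thus ?thesis using x mem by (intro bexI[of _ x]) auto
    next
      case 2
      have "S - {x} \<in> layer ?Y (d - 1)" if "S \<in> layer X d" "x \<in> S" for S
        using that by (auto simp: layer_def)
      thus ?thesis using x 2 mem by (intro bexI[of _ x]) auto
    next
      case 3
      obtain y where y: "y \<in> ?Y"
        "(\<forall>S\<in>?A1. y \<in> S) \<or> (\<forall>S\<in>layer ?Y (d - 1). y \<in> S \<longrightarrow> S \<in> ?A1)"
        using IH[OF A1] by blast
      \<comment> \<open>Otherwise the complemented family has in its deletion at \<open>x\<close>
        every set of its degree without \<open>y\<close>, and also a set through \<open>y\<close>;
        by its size it falls under \<open>not_shadow_minimal\<close>.\<close>
      have "\<forall>S\<in>?A1. y \<in> S"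
      proof (rule ccontr)
        assume ny: "\<not> ?thesis"
        then obtain S where S: "S \<in> ?A1" "y \<notin> S" by blast
        have star: "T \<in> ?A1" if "T \<in> layer ?Y (d - 1)" "y \<in> T" for T using y(2) ny that by blast
        let ?G = "(-) X ` A" and ?k = "card X - d"
        have lG: "link x ?G = (-) ?Y ` ?A0" and dG: "del x ?G = (-) ?Y ` ?A1"
          using link_compl[OF AX x] del_compl[OF AX x] .
        have "?Y - S \<in> del x ?G" using S(1) dG by auto
        moreover have "insert y (?Y - S - {y}) = ?Y - S" using S(2) y(1) by auto
        ultimately have "?Y - S - {y} \<in> link y (del x ?G)" by (simp add: link_def)
        hence P: "link y (del x ?G) \<noteq> {}" by blast
        have full: "layer (?Y - {y}) ?k \<subseteq> del x ?G"
        proof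
          fix U assume U: "U \<in> layer (?Y - {y}) ?k"
          hence "U \<subseteq> ?Y" "y \<notin> U" "card U = ?k" "finite U" by (auto simp: layer_def)
          hence "?Y - U \<in> layer ?Y (d - 1)"
            using Y d y(1) by (auto simp: layer_def card_Diff_subset)
          hence "?Y - U \<in> ?A1" using star y(1) \<open>y \<notin> U\<close> by blast
          moreover have "U = ?Y - (?Y - U)" using \<open>U \<subseteq> ?Y\<close> by auto
          ultimately show "U \<in> del x ?G" unfolding dG by blast
        qed
        have cG: "card ?G \<le> card X - 1 choose ?k"
        proof -
          have "card ?G \<le> card A" using X AX by (meson card_image_le finite_layer finite_subset)
          also have "\<dots> \<le> card X - 1 choose (d - 1)" by (rule 3)
          also have "\<dots> = card X - 1 choose ?k"
            using binomial_symmetric[of "d - 1" "card X - 1"] d by (simp add: Suc_diff_le)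
          finally show ?thesis .
        qed
        have GX: "?G \<subseteq> layer X ?k" using AX X by (auto simp: layer_def card_Diff_subset)
        have "\<not> shadow_minimal ?k ?G"
          by (rule not_shadow_minimal[OF X x GX _ _ _ full P cG])
            (use d 3(1) up in \<open>simp_all add: lG dG\<close>)
        thus False using A by (simp add: bigotzmann_def)
      qed
      \<comment> \<open>By \<open>up\<close>, each set of the deletion extends a set of the link and
        so inherits \<open>y\<close>.\<close>
      moreover have "y \<in> S" if "S \<in> ?A0" for S
      proof -
        have "?Y - S \<in> shadow ((-) ?Y ` ?A1)" using up that by blast
        then obtain z where z: "insert z (?Y - S) \<in> (-) ?Y ` ?A1" by (rule shadowE)
        then obtain T where "T \<in> ?A1" "insert z (?Y - S) = ?Y - T" by blast
        thus ?thesis using calculation y(1) by blast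
      qed
      ultimately have "\<forall>S\<in>A. y \<in> S" using mem by (metis DiffD1)
      thus ?thesis using y(1) by blast
    next
      case 4
      obtain z where z: "z \<in> ?Y"
        "(\<forall>S\<in>?A0. z \<in> S) \<or> (\<forall>S\<in>layer ?Y d. z \<in> S \<longrightarrow> S \<in> ?A0)"
        using IH[OF A0] by blast
      let ?B = "layer X d - A"
      have lB: "link x ?B = layer ?Y (d - 1) - ?A1" and dB: "del x ?B = layer ?Y d - ?A0"
        using link_del_layer_Diff[OF x, of d A] d by auto
      \<comment> \<open>Mirror image of the previous case, with the missing sets in place of the
        complemented ones; Pascal's rule turns the lower bound on \<open>card A\<close> into an
        upper bound on \<open>card ?B\<close>.\<close>
      have star: "\<forall>S\<in>layer ?Y d. z \<in> S \<longrightarrow> S \<in> ?A0"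
      proof (rule ccontr)
        assume nz: "\<not> ?thesis"
        then obtain S where S: "S \<in> layer ?Y d" "z \<in> S" "S \<notin> ?A0" by blast
        have "S - {z} \<in> link z (del x ?B)" using S by (simp add: link_def insert_absorb dB)
        hence P: "link z (del x ?B) \<noteq> {}" by blast
        have full: "layer (?Y - {z}) d \<subseteq> del x ?B"
          unfolding dB using nz z(2) by (auto simp: layer_def)
        have "card X choose d = (card X - 1 choose (d - 1)) + (card X - 1 choose d)"
          using d by (intro choose_reduce_nat) auto
        moreover have "card ?B = (card X choose d) - card A"
          using X AX card_layer[OF X, of d] by (simp add: card_Diff_subset finite_subset)
        ultimately have cB: "card ?B \<le> card X - 1 choose d" using 4(3) by linarith
        have "\<not> shadow_minimal d ?B"
          by (rule not_shadow_minimal[OF X x _ _ _ _ full P cB])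
            (use d 4(2) dn in \<open>auto simp: lB dB\<close>)
        thus False using A by (simp add: bigotzmann_def)
      qed
      have "S \<in> A" if S: "S \<in> layer X d" "z \<in> S" for S
      proof (cases "x \<in> S")
        case False
        hence "S \<in> layer ?Y d" using S by (auto simp: layer_def)
        thus ?thesis using star S False mem by auto
      next
        case True
        \<comment> \<open>By \<open>dn\<close>, a missing set would extend to a \<open>d\<close>-set
          outside the deletion, but every such extension contains \<open>z\<close>.\<close>
        have "S - {x} \<in> ?A1"
        proof (rule ccontr)
          assume "S - {x} \<notin> ?A1"
          hence "S - {x} \<in> shadow (layer ?Y d - ?A0)" using dn S True by (auto simp: layer_def)
          then obtain w where w: "insert w (S - {x}) \<in> layer ?Y d - ?A0" by (rule shadowE)
          hence "insert w (S - {x}) \<in> ?A0"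
            using S(2) z(1) by (intro star[rule_format]) simp_all
          thus False using w by simp
        qed
        thus ?thesis using True mem by simp
      qed
      thus ?thesis using z(1) by blast
    qed
  qed
qed

section \<open>Building the ordering of the variables\<close>

text \<open>The order is a list, so that it can be built by prepending one variable at a time; the
  inner condition is \<open>lex_gt\<close> for the order \<open>(!) xs\<close>.\<close>

definition lex_closed :: "nat list \<Rightarrow> nat \<Rightarrow> nat set set \<Rightarrow> bool" where
  "lex_closed xs d A \<longleftrightarrow> (\<forall>S\<in>A. \<forall>T\<in>layer (set xs) d.
     (\<exists>k<length xs. xs ! k \<in> T \<and> xs ! k \<notin> S \<and> (\<forall>i<k. xs ! i \<in> T \<longleftrightarrow> xs ! i \<in> S)) \<longrightarrow> T \<in> A)"

text \<open>If \<open>S\<close> and \<open>T\<close> differ at \<open>x\<close>, then only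
  \<open>T\<close> contains it; this excludes the first alternative, and the second puts
  \<open>T\<close> into \<open>A\<close> outright. Otherwise both sets belong to the same part, and
  either the star or the order on the tail decides.\<close>

lemma lex_closed_Cons:
  assumes x: "x \<notin> set xs" and A: "A \<subseteq> layer (insert x (set xs)) d"
    and star: "(\<forall>S\<in>A. x \<in> S) \<and> lex_closed xs (d - 1) (link x A) \<or>
      (\<forall>S\<in>layer (insert x (set xs)) d. x \<in> S \<longrightarrow> S \<in> A) \<and> lex_closed xs d (del x A)"
  shows "lex_closed (x # xs) d A"
  unfolding lex_closed_def
proof (intro ballI impI)
  fix S T assume S: "S \<in> A" and T: "T \<in> layer (set (x # xs)) d"
    and "\<exists>k<length (x # xs). (x # xs) ! k \<in> T \<and> (x # xs) ! k \<notin> S \<and>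
      (\<forall>i<k. (x # xs) ! i \<in> T \<longleftrightarrow> (x # xs) ! i \<in> S)"
  then obtain k where k: "k < Suc (length xs)" "(x # xs) ! k \<in> T" "(x # xs) ! k \<notin> S"
    "\<And>i. i < k \<Longrightarrow> (x # xs) ! i \<in> T \<longleftrightarrow> (x # xs) ! i \<in> S" by auto
  show "T \<in> A"
  proof (cases k)
    case 0
    thus ?thesis using star S T k by auto
  next
    case (Suc j)
    have j: "j < length xs" "xs ! j \<in> T" "xs ! j \<notin> S" using k Suc by auto
    have below: "xs ! i \<in> T \<longleftrightarrow> xs ! i \<in> S" if "i < j" for i using k(4)[of "Suc i"] Suc that by simp
    have xTS: "x \<in> T \<longleftrightarrow> x \<in> S" using k(4)[of 0] Suc by simp
    have ne: "xs ! i \<noteq> x" if "i < length xs" for i using x that by auto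
    \<comment> \<open>The comparison along \<open>xs\<close> ignores \<open>x\<close>, so it carries
      over to the sets of the link.\<close>
    have lex: "T' \<in> A'" if "lex_closed xs d' A'" "S' \<in> A'" "T' \<in> layer (set xs) d'"
      "T' - {x} = T - {x}" "S' - {x} = S - {x}" for T' S' A' d'
    proof -
      have "xs ! i \<in> T' \<longleftrightarrow> xs ! i \<in> T" "xs ! i \<in> S' \<longleftrightarrow> xs ! i \<in> S" if "i < length xs" for i
        using \<open>T' - {x} = T - {x}\<close> \<open>S' - {x} = S - {x}\<close> ne[OF that] by blast+
      hence "\<exists>k<length xs. xs ! k \<in> T' \<and> xs ! k \<notin> S' \<and> (\<forall>i<k. xs ! i \<in> T' \<longleftrightarrow> xs ! i \<in> S')"
        using j below by (intro exI[of _ j]) auto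
      thus ?thesis using that unfolding lex_closed_def by blast
    qed
    show ?thesis
    proof (cases "x \<in> T")
      case True
      show ?thesis
      proof (cases "\<forall>S\<in>layer (insert x (set xs)) d. x \<in> S \<longrightarrow> S \<in> A")
        case False
        hence "lex_closed xs (d - 1) (link x A)" using star by blast
        moreover have "S - {x} \<in> link x A" using S True xTS by (simp add: link_def insert_absorb)
        moreover have "T - {x} \<in> layer (set xs) (d - 1)" using T True by (auto simp: layer_def)
        ultimately have "T - {x} \<in> link x A" by (rule lex) auto
        thus ?thesis using True by (simp add: link_def insert_absorb)
      qed (use True T in auto)
    next
      case False
      hence "lex_closed xs d (del x A)" using star S xTS by blast
      moreover have "S \<in> del x A" using S False xTS by (simp add: del_def)
      moreover have "T \<in> layer (set xs) d" using T False by (auto simp: layer_def)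
      ultimately have "T \<in> del x A" by (rule lex) auto
      thus ?thesis by (simp add: del_def)
    qed
  qed
qed

text \<open>The variable of \<open>star_dichotomy\<close> comes first and the induction hypothesis
  orders the others; trivial families accept any order.\<close>

lemma bigotzmann_lex_closed:
  assumes "finite X" "bigotzmann X d A"
  shows "\<exists>xs. distinct xs \<and> set xs = X \<and> lex_closed xs d A"
  using assms
proof (induction "card X" arbitrary: X d A rule: less_induct)
  case less
  note X = \<open>finite X\<close> and A = \<open>bigotzmann X d A\<close>
  have AX: "A \<subseteq> layer X d" using A by (simp add: bigotzmann_def)
  show ?case
  proof (cases "A = {} \<or> A = layer X d")
    case True
    obtain xs where "set xs = X" "distinct xs" using finite_distinct_list[OF X] by blast
    thus ?thesis using True by (auto simp: lex_closed_def)
  next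
    case False
    have d: "0 < d" "d < card X" using nontrivial_family_degree[OF X AX] False by auto
    hence "X \<noteq> {}" by auto
    then obtain x where x: "x \<in> X"
      and star: "(\<forall>S\<in>A. x \<in> S) \<or> (\<forall>S\<in>layer X d. x \<in> S \<longrightarrow> S \<in> A)"
      using star_dichotomy[OF X _ A] by blast
    let ?Y = "X - {x}"
    have Y: "finite ?Y" "card ?Y < card X" using X card_Diff1_less[OF X x] by simp_all
    \<comment> \<open>\<open>star_dichotomy\<close> does not say that the parts at this
      \<open>x\<close> inherit the properties. Closedness would put a set into the deletion although
      it is empty when \<open>A\<close> lies in the star; when \<open>A\<close> contains the star,
      every set without \<open>x\<close> would be reached from one through \<open>x\<close>, making
      \<open>A\<close> full.\<close>
    have "\<not> (\<forall>S\<in>link x A. \<forall>y\<in>?Y - S. insert y S \<in> del x A)"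
    proof
      assume up: "\<forall>S\<in>link x A. \<forall>y\<in>?Y - S. insert y S \<in> del x A"
      show False
      proof (cases "\<forall>S\<in>A. x \<in> S")
        case True
        obtain S where S: "S \<in> A" "x \<in> S" using True False by blast
        hence "S - {x} \<in> link x A" by (simp add: link_def insert_absorb)
        moreover obtain y where "y \<in> X - S"
        proof -
          have "S \<noteq> X" "S \<subseteq> X" using S AX d by (auto simp: layer_def)
          thus ?thesis using that by blast
        qed
        ultimately have "insert y (S - {x}) \<in> del x A" using up S by auto
        thus False using True by (auto simp: del_def)
      next
        case False
        hence st: "\<forall>S\<in>layer X d. x \<in> S \<longrightarrow> S \<in> A" using star by blast
        have "T \<in> A" if T: "T \<in> layer X d" for T
        proof (cases "x \<in> T")
          case False
          obtain y where y: "y \<in> T" using T d by (fastforce simp: layer_def)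
          have "insert x (T - {y}) \<in> layer X d"
            using T y x False d by (auto simp: layer_def)
          hence "T - {y} \<in> link x A" using st False by (simp add: link_def)
          moreover have "y \<in> ?Y - (T - {y})" using y T False by (auto simp: layer_def)
          ultimately have "insert y (T - {y}) \<in> del x A" using up by blast
          thus ?thesis using y by (simp add: del_def insert_absorb)
        qed (use st T in auto)
        thus False using \<open>\<not> (A = {} \<or> A = layer X d)\<close> AX by blast
      qed
    qed
    hence "bigotzmann ?Y (d - 1) (link x A)" "bigotzmann ?Y d (del x A)"
      using bigotzmann_step[OF X x d A] by auto
    hence *: "\<exists>xs. distinct xs \<and> set xs = ?Y \<and> lex_closed xs (d - 1) (link x A)"
      "\<exists>xs. distinct xs \<and> set xs = ?Y \<and> lex_closed xs d (del x A)"
      using less.hyps[OF Y(2,1)] by blast+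
    \<comment> \<open>The order is taken from the link if \<open>A\<close> lies in the star and from
      the deletion if \<open>A\<close> contains it; the other part is then empty or full.\<close>
    have "\<exists>xs. distinct xs \<and> set xs = ?Y \<and>
        ((\<forall>S\<in>A. x \<in> S) \<and> lex_closed xs (d - 1) (link x A) \<or>
         (\<forall>S\<in>layer X d. x \<in> S \<longrightarrow> S \<in> A) \<and> lex_closed xs d (del x A))"
      using star * by blast
    then obtain xs where xs: "distinct xs" "set xs = ?Y"
        "(\<forall>S\<in>A. x \<in> S) \<and> lex_closed xs (d - 1) (link x A) \<or>
         (\<forall>S\<in>layer X d. x \<in> S \<longrightarrow> S \<in> A) \<and> lex_closed xs d (del x A)" by blast
    have ins: "insert x (set xs) = X" using xs(2) x by auto
    have "lex_closed (x # xs) d A"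
    proof (rule lex_closed_Cons)
      show "x \<notin> set xs" using xs(2) by simp
    qed (use AX xs(3) in \<open>simp_all only: ins\<close>)
    thus ?thesis using xs ins by (intro exI[of _ "x # xs"]) auto
  qed
qed

section \<open>From Gotzmann spaces to minimal shadows\<close>

interpretation sqf: vector_space "scal :: 'k::field \<Rightarrow> (nat set \<Rightarrow> 'k) \<Rightarrow> _"
  by (rule vector_space_scal)

lemma sum_apply: "(\<Sum>a\<in>A. g a) S = (\<Sum>a\<in>A. g a S)" for g :: "'b \<Rightarrow> 'c \<Rightarrow> 'k::field"
  by (induction A rule: infinite_finite_induct) auto

lemma inj_mono: "inj (mono :: nat set \<Rightarrow> nat set \<Rightarrow> 'k::field)"
proof (rule injI)
  fix S T assume "(mono S :: nat set \<Rightarrow> 'k) = mono T"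
  hence "(mono S :: nat set \<Rightarrow> 'k) S = mono T S" by simp
  thus "S = T" by (simp add: mono_def split: if_splits)
qed

lemma independent_mono:
  assumes "finite M"
  shows "sqf.independent (mono ` M :: (nat set \<Rightarrow> 'k::field) set)"
proof (rule sqf.independent_if_scalars_zero)
  show "finite (mono ` M :: (nat set \<Rightarrow> 'k) set)" using assms by simp
next
  fix f :: "(nat set \<Rightarrow> 'k) \<Rightarrow> 'k" and v
  assume 0: "(\<Sum>x\<in>mono ` M. scal (f x) x) = 0" and "v \<in> (mono ` M :: (nat set \<Rightarrow> 'k) set)"
  then obtain S where S: "S \<in> M" "v = mono S" by auto
  have "0 = (\<Sum>x\<in>mono ` M. scal (f x) x) S" using 0 by simp
  also have "\<dots> = (\<Sum>T\<in>M. f (mono T) * mono T S)"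
    by (simp add: sum_apply scal_def sum.reindex inj_on_subset[OF inj_mono])
  also have "\<dots> = (\<Sum>T\<in>M. if T = S then f (mono S) else 0)"
    by (rule sum.cong) (auto simp: mono_def)
  also have "\<dots> = f v" using S assms by simp
  finally show "f v = 0" by simp
qed

lemma vdim_monospace:
  "finite M \<Longrightarrow> vdim (monospace M :: (nat set \<Rightarrow> 'k::field) set) = card M"
  unfolding monospace_def
  by (subst sqf.dim_span_eq_card_independent[OF independent_mono])
    (auto intro: card_image inj_on_subset[OF inj_mono])

definition upper_shadow :: "nat set \<Rightarrow> nat set set \<Rightarrow> nat set set" where
  "upper_shadow X M = {insert j S | j S. S \<in> M \<and> j \<in> X - S}"

lemma mulx_mono: "mulx j (mono S) = (if j \<in> S then 0 else mono (insert j S) :: nat set \<Rightarrow> 'k::field)"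
  by (auto simp: mulx_def mono_def fun_eq_iff)

text \<open>A variable times a monomial is a monomial or zero. General vectors are covered because
  the preimage of a subspace under multiplication by a variable is a subspace.\<close>

lemma m1_monospace:
  "m1 n (monospace M :: (nat set \<Rightarrow> 'k::field) set) = monospace (upper_shadow {0..<n} M)"
proof
  let ?U = "monospace (upper_shadow {0..<n} M) :: (nat set \<Rightarrow> 'k) set"
  have sU: "vsubspace ?U" unfolding monospace_def by (rule sqf.subspace_span)
  have "mulx j w \<in> ?U" if j: "j < n" and w: "w \<in> monospace M" for j w
  proof -
    have "vsubspace {v. mulx j v \<in> ?U}"
    proof (rule sqf.subspaceI)
      have "mulx j (0 :: nat set \<Rightarrow> 'k) = 0" by (auto simp: mulx_def fun_eq_iff)
      thus "0 \<in> {v. mulx j v \<in> ?U}" using sqf.subspace_0[OF sU] by simp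
    next
      fix u v :: "nat set \<Rightarrow> 'k"
      have "mulx j (u + v) = mulx j u + mulx j v" by (auto simp: mulx_def fun_eq_iff)
      thus "u \<in> {v. mulx j v \<in> ?U} \<Longrightarrow> v \<in> {v. mulx j v \<in> ?U} \<Longrightarrow> u + v \<in> {v. mulx j v \<in> ?U}"
        using sqf.subspace_add[OF sU] by simp
    next
      fix c and v :: "nat set \<Rightarrow> 'k"
      have "mulx j (scal c v) = scal c (mulx j v)" by (auto simp: mulx_def scal_def fun_eq_iff)
      thus "v \<in> {v. mulx j v \<in> ?U} \<Longrightarrow> scal c v \<in> {v. mulx j v \<in> ?U}"
        using sqf.subspace_scale[OF sU] by simp
    qed
    moreover have "mono ` M \<subseteq> {v. mulx j v \<in> ?U}"
    proof clarify
      fix S assume S: "S \<in> M"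
      show "mulx j (mono S) \<in> ?U"
      proof (cases "j \<in> S")
        case True
        thus ?thesis using sqf.subspace_0[OF sU] by (simp add: mulx_mono)
      next
        case False
        hence "insert j S \<in> upper_shadow {0..<n} M" using S j by (auto simp: upper_shadow_def)
        thus ?thesis using False unfolding monospace_def mulx_mono by (auto intro: sqf.span_base)
      qed
    qed
    ultimately have "monospace M \<subseteq> {v. mulx j v \<in> ?U}"
      unfolding monospace_def by (rule sqf.span_minimal[rotated])
    thus ?thesis using w by auto
  qed
  thus "m1 n (monospace M) \<subseteq> ?U" unfolding m1_def by (intro sqf.span_minimal[OF _ sU]) auto
  show "?U \<subseteq> m1 n (monospace M)"
    unfolding m1_def monospace_def[of "upper_shadow {0..<n} M"]
  proof (rule sqf.span_mono, clarify)
    fix T assume "T \<in> upper_shadow {0..<n} M"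
    then obtain j S where jS: "T = insert j S" "S \<in> M" "j < n" "j \<notin> S" by (auto simp: upper_shadow_def)
    have "(mono T :: nat set \<Rightarrow> 'k) = mulx j (mono S)" using jS by (simp add: mulx_mono)
    moreover have "(mono S :: nat set \<Rightarrow> 'k) \<in> monospace M"
      unfolding monospace_def using jS by (auto intro: sqf.span_base)
    ultimately show "\<exists>j w. (mono T :: nat set \<Rightarrow> 'k) = mulx j w \<and> j < n \<and> w \<in> monospace M" using jS by blast
  qed
qed

text \<open>Only monomial competitors are tested; for them all dimensions involved are
  cardinalities.\<close>

lemma gotzmann_upper_shadow_le:
  assumes g: "gotzmann n d (monospace M :: (nat set \<Rightarrow> 'k::field) set)"
    and M: "M \<subseteq> layer {0..<n} d" and N: "N \<subseteq> layer {0..<n} d" "card N = card M"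
  shows "card (upper_shadow {0..<n} M) \<le> card (upper_shadow {0..<n} N)"
proof -
  have fin: "finite M" "finite N" using M N finite_subset[OF _ finite_layer[of "{0..<n}" d]] by auto
  have fup: "finite (upper_shadow {0..<n} K)" if "K \<subseteq> layer {0..<n} d" for K
    by (rule finite_subset[of _ "Pow {0..<n}"]) (use that in \<open>auto simp: upper_shadow_def layer_def\<close>)
  let ?W = "monospace N :: (nat set \<Rightarrow> 'k) set"
  have "?W \<subseteq> Rdeg n d" unfolding monospace_def
  proof (rule sqf.span_minimal)
    show "mono ` N \<subseteq> (Rdeg n d :: (nat set \<Rightarrow> 'k) set)"
      using N(1) by (auto simp: Rdeg_def mono_def sqfree_def layer_def split: if_splits)
    show "vsubspace (Rdeg n d :: (nat set \<Rightarrow> 'k) set)"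
      by (rule sqf.subspaceI) (auto simp: Rdeg_def scal_def)
  qed
  moreover have "vsubspace ?W" unfolding monospace_def by (rule sqf.subspace_span)
  moreover have "vdim ?W = vdim (monospace M :: (nat set \<Rightarrow> 'k) set)"
    using fin N(2) by (simp add: vdim_monospace)
  ultimately have "vdim (m1 n (monospace M :: (nat set \<Rightarrow> 'k) set)) \<le> vdim (m1 n ?W)"
    using g unfolding gotzmann_def by blast
  thus ?thesis using fup[OF M] fup[OF N(1)] by (simp add: m1_monospace vdim_monospace)
qed

text \<open>Removing a point from the complement is adding it to the set, so results on lower
  shadows apply to multiplication by variables.\<close>

lemma shadow_compl:
  assumes "M \<subseteq> Pow X"
  shows "shadow ((-) X ` M) = (-) X ` upper_shadow X M"
proof
  show "shadow ((-) X ` M) \<subseteq> (-) X ` upper_shadow X M"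
  proof
    fix T assume "T \<in> shadow ((-) X ` M)"
    then obtain S x where "S \<in> M" "x \<in> X - S" "T = X - S - {x}" by (auto simp: shadow_def)
    thus "T \<in> (-) X ` upper_shadow X M"
      by (intro image_eqI[of _ _ "insert x S"]) (auto simp: upper_shadow_def)
  qed
  show "(-) X ` upper_shadow X M \<subseteq> shadow ((-) X ` M)"
  proof
    fix T assume "T \<in> (-) X ` upper_shadow X M"
    then obtain S x where S: "S \<in> M" "x \<in> X - S" "T = X - insert x S" by (auto simp: upper_shadow_def)
    hence "T = X - S - {x}" by auto
    thus "T \<in> shadow ((-) X ` M)" using S by (auto intro: shadowI)
  qed
qed

lemma compl_layer:
  assumes "finite X" "M \<subseteq> layer X d"
  shows "(-) X ` M \<subseteq> layer X (card X - d)" "card ((-) X ` M) = card M" "(-) X ` (-) X ` M = M"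
    "card (shadow ((-) X ` M)) = card (upper_shadow X M)"
proof -
  have P: "M \<subseteq> Pow X" using assms(2) by (auto simp: layer_def)
  show "(-) X ` M \<subseteq> layer X (card X - d)" using assms by (auto simp: layer_def card_Diff_subset)
  show "card ((-) X ` M) = card M" by (rule card_image) (rule inj_on_subset[OF inj_on_compl P])
  have "X - (X - S) = S" if "S \<in> M" for S using P that by blast
  thus "(-) X ` (-) X ` M = M" by (simp add: image_image)
  have "upper_shadow X M \<subseteq> Pow X" using P by (auto simp: upper_shadow_def)
  thus "card (shadow ((-) X ` M)) = card (upper_shadow X M)"
    unfolding shadow_compl[OF P] by (intro card_image inj_on_subset[OF inj_on_compl])
qed

text \<open>A competitor over arbitrary naturals is compressed into \<open>{0..<n}\<close>, where it
  has room because it is as large as \<open>M\<close>, and then complemented to a competitor in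
  degree \<open>d\<close>.\<close>

lemma gotzmann_imp_shadow_minimal:
  assumes g: "gotzmann n d (monospace M :: (nat set \<Rightarrow> 'k::field) set)"
    and M: "M \<subseteq> layer {0..<n} d" and d: "d \<le> n"
  shows "shadow_minimal (n - d) ((-) {0..<n} ` M)"
proof -
  let ?X = "{0..<n}"
  note cM = compl_layer[OF _ M, simplified]
  have fM: "finite M" using M by (rule finite_subset) simp
  have "card (shadow ((-) ?X ` M)) \<le> card (shadow G)"
    if G: "finite G" "G \<subseteq> layer UNIV (n - d)" "card G = card ((-) ?X ` M)" for G :: "nat set set"
  proof -
    have "card M \<le> card (layer ?X d)" using M by (intro card_mono) auto
    hence "card G \<le> card ?X choose (n - d)"
      using G(3) d by (simp add: cM(2) card_layer binomial_symmetric[of d n])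
    then obtain R where R: "R \<subseteq> layer ?X (n - d)" "card R = card G" "card (shadow R) \<le> card (shadow G)"
      using shadow_compress_into[OF G(1,2), of ?X] by auto
    note cR = compl_layer[OF _ R(1), simplified]
    let ?N = "(-) ?X ` R"
    have N: "?N \<subseteq> layer ?X d" using cR(1) d by simp
    have "card (shadow ((-) ?X ` M)) = card (upper_shadow ?X M)" by (rule cM(4))
    also have "\<dots> \<le> card (upper_shadow ?X ?N)"
      by (rule gotzmann_upper_shadow_le[OF g M N]) (use R(2) G(3) cM(2) cR(2) in simp)
    also have "\<dots> = card (shadow ((-) ?X ` ?N))" using compl_layer(4)[OF _ N] by simp
    also have "(-) ?X ` ?N = R" by (rule cR(3))
    finally show ?thesis using R(3) by simp
  qed
  moreover have "(-) ?X ` M \<subseteq> layer UNIV (n - d)" using cM(1) by (auto simp: layer_def)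
  ultimately show ?thesis using fM by (auto simp: shadow_minimal_def)
qed

theorem theorem4p13:
  fixes n d :: nat and M :: "nat set set"
  assumes "M \<subseteq> sqfree n d"
    and "gotzmann n d (monospace M :: (nat set \<Rightarrow> 'k::field) set)"
    and "gotzmann_dual TYPE('k) n d M"
  shows "\<exists>p. bij_betw p {0..<n} {0..<n} \<and> lex_segment n d p M"
proof (cases "d \<le> n")
  case False
  have "sqfree n d = {}"
  proof -
    have "card S \<le> n" if "S \<subseteq> {0..<n}" for S using card_mono[OF finite_atLeastLessThan that] by simp
    thus ?thesis using False by (auto simp: sqfree_def)
  qed
  thus ?thesis using assms(1) by (intro exI[of _ id]) (auto simp: lex_segment_def)
next
  case True
  let ?X = "{0..<n}"
  have sq: "sqfree n d = layer ?X d"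
    using finite_subset[OF _ finite_atLeastLessThan] by (auto simp: sqfree_def layer_def)
  have M: "M \<subseteq> layer ?X d" using assms(1) sq by simp
  let ?B = "layer ?X d - M"
  have B: "?B \<subseteq> layer ?X d" by auto
  note cB = compl_layer[OF _ B, simplified]
  have dual: "alex_dual n d M = (-) ?X ` ?B" by (auto simp: alex_dual_def sq)
  \<comment> \<open>Complementing the Alexander dual returns the monomials missing from
    \<open>M\<close>, in degree \<open>n - (n - d) = d\<close>.\<close>
  have "shadow_minimal (n - (n - d)) ((-) ?X ` (-) ?X ` ?B)"
    by (rule gotzmann_imp_shadow_minimal)
      (use assms(3) cB(1) in \<open>simp_all add: gotzmann_dual_def dual\<close>)
  hence "shadow_minimal d ?B" using True cB(3) by simp
  hence "bigotzmann ?X d M"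
    using gotzmann_imp_shadow_minimal[OF assms(2) M True] M by (simp add: bigotzmann_def)
  then obtain xs where xs: "distinct xs" "set xs = ?X" "lex_closed xs d M"
    using bigotzmann_lex_closed[of ?X d M] by auto
  have len: "length xs = n" using distinct_card[OF xs(1)] xs(2) by simp
  have "bij_betw ((!) xs) ?X ?X"
    by (rule bij_betw_nth) (use xs len in \<open>auto simp: lessThan_atLeast0\<close>)
  moreover have "lex_segment n d ((!) xs) M"
    using M xs len by (simp add: lex_segment_def lex_closed_def lex_gt_def sq)
  ultimately show ?thesis by blast
qed

end
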